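(* Let $\mathbf S$ be a surface with a family of asymptotic curves. Suppose that at each point $P$ of $\mathbf S$ there is given a pencil of planes through $P$, projectively related to the pencil of tangents to $\mathbf S$ at $P$, and such that the plane of the pencil corresponding to the asymptotic tangent $dx=0$ is the only plane of the pencil which intersects the embedded tangent plane $\Pi_P$ in a line. Then the system of curves on $\mathbf S$ whose osculating plane at each of their points $P$ intersects in a line the plane of the pencil at $P$ corresponding to their tangent at $P$ satisfies an equation $$u''=A+Bu'+Cu'^2+Du'^3,\qquad u'=\frac{du}{dx},\ u''=\frac{d^2u}{dx^2},$$ with $A,B,C,D$ functions of $(x,u)$. Conversely, each equation of this type represents such a system of curves.
   Context: Everything is local and complex analytic. A surface $\mathbf S\subset\mathbb{C}P_n$ is given by a vector of homogeneous coordinates $y=y(x,u)$. The embedded tangent plane $\Pi_P$ at $P=y$ is the projective plane spanned by $y,y_x,y_u$. $S(2,0)$ at $P$ is the projective span of $y,y_x,y_u,y_{xx},y_{xu},y_{uu}$. The osculating plane of a curve at $P$ is the plane spanned by $y,y',y''$, derivatives being taken along the curve. A surface with a family of asymptotic curves is a surface satisfying, in suitable parameters $(x,u)$ (the ones used here), a "parabolic" equation $$y_{uu}=ay_x+by_u+cy,$$ with $a,b,c$ functions of $(x,u)$, and with $S(2,0)=\mathbb{C}P_4$ (so that $y,y_x,y_u,y_{xx},y_{xu}$ are linearly independent); the curves $dx=0$ are the asymptotics, and the asymptotic tangent at $P$ is the tangent line with $dx=0$. Curves of the system are considered away from the asymptotic curves $dx=0$, i.e. in the form $u=u(x)$. The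 pencils of planes considered lie in the space $S(2,0)=\mathbb{C}P_4$ at $P$, depend analytically on $P$, and have as axis (base) a line through $P$; such a pencil is the one-parameter linear family $x_1S_1+x_2S_2$, $[x_1:x_2]\in\mathbb{C}P_1$, generated by two distinct planes $S_1,S_2$ through the axis. The pencil of tangents to $\mathbf S$ at $P$ is the set of lines through $P$ tangent to $\mathbf S$ at $P$, with projective coordinate $[dx:du]$. Two pencils are projectively related when a projective isomorphism (an element of $PGL(2,\mathbb{C})$ in the pencil coordinates) between them is given; through it, each tangent $t$ at $P$ has a corresponding plane of the pencil at $P$. *)

theory Defs
  imports "HOL-Complex_Analysis.Complex_Analysis"
begin

text \<open>
  Points of \<open>CP\<^sub>n\<close> are given by homogeneous coordinate vectors in \<open>complex ^ 'n\<close>, where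
  \<open>CARD('n) = n + 1\<close>, and projective subspaces by the corresponding linear subspaces over
  the complex numbers: a projective line has \<^const>\<open>vec.dim\<close> 2, a plane 3, and
  \<open>CP\<^sub>4\<close> has 5.  Points of the parameter domain are pairs \<open>(x, u)\<close>.
\<close>

text \<open>
  Analyticity in two variables, to be used on open sets: Frechet differentiability with a
  complex-linear derivative.
\<close>

definition analytic2_on :: "(complex \<times> complex \<Rightarrow> complex) \<Rightarrow> (complex \<times> complex) set \<Rightarrow> bool" where
  "analytic2_on f U \<longleftrightarrow>
     (\<forall>p\<in>U. \<exists>f\<^sub>x f\<^sub>u. (f has_derivative (\<lambda>(h, k). f\<^sub>x * h + f\<^sub>u * k)) (at p))"

definition vec_analytic2_on ::
  "(complex \<times> complex \<Rightarrow> complex ^ 'n) \<Rightarrow> (complex \<times> complex) set \<Rightarrow> bool" where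
  "vec_analytic2_on f U \<longleftrightarrow> (\<forall>i. analytic2_on (\<lambda>p. f p $ i) U)"

definition vec_deriv :: "(complex \<Rightarrow> complex ^ 'n) \<Rightarrow> complex \<Rightarrow> complex ^ 'n" where
  "vec_deriv g t = (\<chi> i. deriv (\<lambda>s. g s $ i) t)"

definition partial_x :: "(complex \<times> complex \<Rightarrow> complex ^ 'n) \<Rightarrow> complex \<times> complex \<Rightarrow> complex ^ 'n" where
  "partial_x f p = vec_deriv (\<lambda>s. f (s, snd p)) (fst p)"

definition partial_u :: "(complex \<times> complex \<Rightarrow> complex ^ 'n) \<Rightarrow> complex \<times> complex \<Rightarrow> complex ^ 'n" where
  "partial_u f p = vec_deriv (\<lambda>s. f (fst p, s)) (snd p)"

definition tangent_plane ::
  "(complex \<times> complex \<Rightarrow> complex ^ 'n) \<Rightarrow> complex \<times> complex \<Rightarrow> (complex ^ 'n) set" where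
  "tangent_plane y p = vec.span {y p, partial_x y p, partial_u y p}"

text \<open>The space \<open>S(2,0)\<close> at a point; \<open>y\<^sub>x\<^sub>u\<close> is \<open>partial_u (partial_x y)\<close>.\<close>

definition S20 ::
  "(complex \<times> complex \<Rightarrow> complex ^ 'n) \<Rightarrow> complex \<times> complex \<Rightarrow> (complex ^ 'n) set" where
  "S20 y p = vec.span {y p, partial_x y p, partial_u y p,
     partial_x (partial_x y) p, partial_u (partial_x y) p, partial_u (partial_u y) p}"

definition surface_with_asymptotics ::
  "(complex \<times> complex) set \<Rightarrow> (complex \<times> complex \<Rightarrow> complex ^ 'n) \<Rightarrow> bool" where
  "surface_with_asymptotics U y \<longleftrightarrow>
     open U \<and> vec_analytic2_on y U \<and>
     (\<exists>a b c. analytic2_on a U \<and> analytic2_on b U \<and> analytic2_on c U \<and>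
        (\<forall>p\<in>U. partial_u (partial_u y) p
                  = a p *s partial_x y p + b p *s partial_u y p + c p *s y p)) \<and>
     (\<forall>p\<in>U. vec.dim (S20 y p) = 5)"

text \<open>
  The plane \<open>x\<^sub>1 S\<^sub>1 + x\<^sub>2 S\<^sub>2\<close> of the pencil with axis spanned by \<open>p\<close> and \<open>v\<close> that is generated
  by the planes \<open>S\<^sub>i\<close> spanned by \<open>p\<close>, \<open>v\<close> and \<open>w\<^sub>i\<close>; here \<open>X\<close> is the vector of the
  homogeneous pencil coordinates \<open>x\<^sub>1, x\<^sub>2\<close>.
\<close>

definition pencil_plane ::
  "complex ^ 'n \<Rightarrow> complex ^ 'n \<Rightarrow> complex ^ 'n \<Rightarrow> complex ^ 'n \<Rightarrow> complex ^ 2 \<Rightarrow> (complex ^ 'n) set" where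
  "pencil_plane p v w\<^sub>1 w\<^sub>2 X = vec.span {p, v, X $ 1 *s w\<^sub>1 + X $ 2 *s w\<^sub>2}"

text \<open>
  \<open>pl p d\<close> is the plane at the point with parameters \<open>p\<close> that corresponds to the tangent with
  homogeneous coordinates \<open>d = [dx : du]\<close> (only nonzero \<open>d\<close> matter).  The matrix \<open>M\<close> is the
  projective isomorphism from the coordinates \<open>[dx : du]\<close> to the pencil coordinates.  Analytic
  dependence on the point means that locally the axis, the two generating planes and the
  isomorphism have analytic representatives.
\<close>

definition related_pencil_field ::
  "(complex \<times> complex) set \<Rightarrow> (complex \<times> complex \<Rightarrow> complex ^ 'n)
     \<Rightarrow> (complex \<times> complex \<Rightarrow> complex ^ 2 \<Rightarrow> (complex ^ 'n) set) \<Rightarrow> bool" where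
  "related_pencil_field U y pl \<longleftrightarrow>
     (\<forall>q\<in>U. \<exists>V v w\<^sub>1 w\<^sub>2 (M :: complex \<times> complex \<Rightarrow> complex ^ 2 ^ 2).
        open V \<and> q \<in> V \<and> V \<subseteq> U \<and>
        vec_analytic2_on v V \<and> vec_analytic2_on w\<^sub>1 V \<and> vec_analytic2_on w\<^sub>2 V \<and>
        (\<forall>i j. analytic2_on (\<lambda>p. M p $ i $ j) V) \<and>
        (\<forall>p\<in>V.
           {v p, w\<^sub>1 p, w\<^sub>2 p} \<subseteq> S20 y p \<and>
           vec.dim {y p, v p} = 2 \<and>
           vec.dim {y p, v p, w\<^sub>1 p} = 3 \<and> vec.dim {y p, v p, w\<^sub>2 p} = 3 \<and>
           vec.span {y p, v p, w\<^sub>1 p} \<noteq> vec.span {y p, v p, w\<^sub>2 p} \<and>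
           invertible (M p) \<and>
           (\<forall>d. d \<noteq> 0 \<longrightarrow> pl p d = pencil_plane (y p) (v p) (w\<^sub>1 p) (w\<^sub>2 p) (M p *v d))))"

definition meet_in_line :: "(complex ^ 'n) set \<Rightarrow> (complex ^ 'n) set \<Rightarrow> bool" where
  "meet_in_line E F \<longleftrightarrow> vec.dim (E \<inter> F) = 2"

definition asymptotic_plane_condition ::
  "(complex \<times> complex) set \<Rightarrow> (complex \<times> complex \<Rightarrow> complex ^ 'n)
     \<Rightarrow> (complex \<times> complex \<Rightarrow> complex ^ 2 \<Rightarrow> (complex ^ 'n) set) \<Rightarrow> bool" where
  "asymptotic_plane_condition U y pl \<longleftrightarrow>
     (\<forall>p\<in>U. meet_in_line (pl p (vector [0, 1])) (tangent_plane y p) \<and>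
        (\<forall>d. d \<noteq> 0 \<and> meet_in_line (pl p d) (tangent_plane y p) \<longrightarrow> pl p d = pl p (vector [0, 1])))"

text \<open>
  A curve of the surface away from the asymptotic directions is a pair \<open>(W, f)\<close>, standing for
  the graph \<open>u = f x\<close> over \<open>W\<close>.
\<close>

definition curves :: "(complex \<times> complex) set \<Rightarrow> (complex set \<times> (complex \<Rightarrow> complex)) set" where
  "curves U = {(W, f). open W \<and> connected W \<and> f holomorphic_on W \<and> (\<forall>x\<in>W. (x, f x) \<in> U)}"

definition osculating_plane ::
  "(complex \<times> complex \<Rightarrow> complex ^ 'n) \<Rightarrow> (complex \<Rightarrow> complex) \<Rightarrow> complex \<Rightarrow> (complex ^ 'n) set" where
  "osculating_plane y f x =
     (let g = (\<lambda>t. y (t, f t)) in vec.span {g x, vec_deriv g x, vec_deriv (vec_deriv g) x})"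

definition pencil_system ::
  "(complex \<times> complex) set \<Rightarrow> (complex \<times> complex \<Rightarrow> complex ^ 'n)
     \<Rightarrow> (complex \<times> complex \<Rightarrow> complex ^ 2 \<Rightarrow> (complex ^ 'n) set)
     \<Rightarrow> (complex set \<times> (complex \<Rightarrow> complex)) set" where
  "pencil_system U y pl = {(W, f) \<in> curves U.
     \<forall>x\<in>W. meet_in_line (osculating_plane y f x) (pl (x, f x) (vector [1, deriv f x]))}"

definition cubic_ode_system ::
  "(complex \<times> complex) set \<Rightarrow> (complex \<times> complex \<Rightarrow> complex) \<Rightarrow> (complex \<times> complex \<Rightarrow> complex)
     \<Rightarrow> (complex \<times> complex \<Rightarrow> complex) \<Rightarrow> (complex \<times> complex \<Rightarrow> complex)
     \<Rightarrow> (complex set \<times> (complex \<Rightarrow> complex)) set" where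
  "cubic_ode_system U A B C D = {(W, f) \<in> curves U.
     \<forall>x\<in>W. deriv (deriv f) x = A (x, f x) + B (x, f x) * deriv f x
              + C (x, f x) * (deriv f x)\<^sup>2 + D (x, f x) * (deriv f x) ^ 3}"

end

theory Submission
  imports Defs
begin

text \<open>
  Modulo \<open>y\<close>, the tangent plane, the osculating plane and the plane of the pencil are
  2-dimensional subspaces of a 4-dimensional space, and two of them meet in a line only if a
  determinant vanishes.  For the tangent plane and the plane of direction \<open>[dx : du]\<close> that determinant
  is linear in \<open>[dx : du]\<close> and, by hypothesis, vanishes exactly at \<open>dx = 0\<close>, so it equals
  \<open>\<kappa> dx\<close> with \<open>\<kappa> \<noteq> 0\<close>.  For the osculating plane of \<open>u = u(x)\<close> and the plane of its tangent it is
  \<open>\<kappa> u'' + P(u')\<close> with \<open>P\<close> of degree at most 4; the coefficient of \<open>u'\<^sup>4\<close> is a multiple of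
  the determinant at \<open>dx = 0\<close> because \<open>y\<^sub>u\<^sub>u\<close> is tangent, hence vanishes.

  Conversely, the pencil with axis direction \<open>y\<^sub>x\<^sub>x - B y\<^sub>x + A y\<^sub>u\<close> and planes through
  \<open>dx (y\<^sub>x\<^sub>u + (2 - b - C)/2 y\<^sub>x) + du ((a - D)/2 y\<^sub>x + y\<^sub>u)\<close> yields the given equation.

  Continuous separately holomorphic functions of two variables are analytic, which gives the
  analyticity and the symmetry of the second derivatives used here.
\<close>

section \<open>Analytic functions of two variables\<close>

definition Dx :: "(complex \<times> complex \<Rightarrow> complex) \<Rightarrow> complex \<times> complex \<Rightarrow> complex" where
  "Dx f p = deriv (\<lambda>s. f (s, snd p)) (fst p)"

definition Du :: "(complex \<times> complex \<Rightarrow> complex) \<Rightarrow> complex \<times> complex \<Rightarrow> complex" where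
  "Du f p = deriv (\<lambda>s. f (fst p, s)) (snd p)"

text \<open>The weak hypothesis of Osgood's lemma. It can be checked for \<open>Dx f\<close> and
  \<open>Du f\<close> one variable at a time, before anything is known about their joint
  differentiability.\<close>

definition separately_holomorphic_on ::
  "(complex \<times> complex \<Rightarrow> complex) \<Rightarrow> (complex \<times> complex) set \<Rightarrow> bool" where
  "separately_holomorphic_on f U \<longleftrightarrow> (\<forall>p\<in>U.
     (\<lambda>s. f (s, snd p)) field_differentiable at (fst p) \<and>
     (\<lambda>s. f (fst p, s)) field_differentiable at (snd p))"

lemma separately_holomorphic_on_DERIV:
  assumes "separately_holomorphic_on f U" "(x, u) \<in> U"
  shows "((\<lambda>s. f (s, u)) has_field_derivative Dx f (x, u)) (at x)"
    and "((\<lambda>s. f (x, s)) has_field_derivative Du f (x, u)) (at u)"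
  using assms unfolding separately_holomorphic_on_def Dx_def Du_def
  by (force simp: DERIV_deriv_iff_field_differentiable)+

lemma Du_swap: "Du (f \<circ> prod.swap) p = Dx f (prod.swap p)"
  by (simp add: Dx_def Du_def)

lemma separately_holomorphic_on_swap:
  "separately_holomorphic_on (f \<circ> prod.swap) (prod.swap ` U) \<longleftrightarrow> separately_holomorphic_on f U"
  by (auto simp: separately_holomorphic_on_def)

lemma open_swap_image: "open (prod.swap ` U)" if "open U" for U :: "('a::topological_space \<times> 'b::topological_space) set"
proof -
  have "prod.swap ` U = prod.swap -` U" by force
  moreover have "continuous_on UNIV (prod.swap :: 'b \<times> 'a \<Rightarrow> 'a \<times> 'b)"
    by (simp add: prod.swap_def[abs_def] continuous_on_Pair continuous_on_fst continuous_on_snd)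
  ultimately show ?thesis using that by (simp add: continuous_on_open_vimage)
qed

lemma cball_times_cball_subset:
  fixes U :: "(complex \<times> complex) set"
  assumes "open U" "(a, b) \<in> U"
  obtains r where "r > 0" "cball a r \<times> cball b r \<subseteq> U"
proof -
  obtain A B where AB: "open A" "open B" "a \<in> A" "b \<in> B" "A \<times> B \<subseteq> U"
    using assms by (metis open_prod_elim mem_Times_iff fst_conv snd_conv)
  obtain r s where "r > 0" "cball a r \<subseteq> A" "s > 0" "cball b s \<subseteq> B"
    using AB by (meson open_contains_cball)
  then have "cball a (min r s) \<times> cball b (min r s) \<subseteq> U" "min r s > 0"
    using AB(5) by (auto simp: subset_iff)
  then show ?thesis by (rule that[rotated])
qed

text \<open>Uniform continuity of \<open>f\<close> on a compact bidisc makes its slices in the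
  second variable converge uniformly as the base point tends to \<open>q\<close>; by Weierstrass,
  their derivatives then converge as well.\<close>

lemma continuous_on_Du:
  assumes U: "open U" and f: "continuous_on U f" and h: "separately_holomorphic_on f U"
  shows "continuous_on U (Du f)"
  unfolding continuous_on_eq_continuous_at[OF U]
proof
  fix q assume "q \<in> U"
  obtain a b where q: "q = (a, b)" by (cases q)
  obtain r where r: "r > 0" "cball a r \<times> cball b r \<subseteq> U"
    using cball_times_cball_subset[OF U] \<open>q \<in> U\<close> q by metis
  have uc: "uniformly_continuous_on (cball a r \<times> cball b r) f"
    by (intro compact_uniformly_continuous continuous_on_subset[OF f] r compact_Times compact_cball)
  \<comment> \<open>Shifting by \<open>snd p\<close> moves every slice to the one disc
    \<open>ball 0 (r/2)\<close>. The radius \<open>r/2\<close> leaves room for the base point itself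
    to move by \<open>r/2\<close> inside the bidisc.\<close>
  define F where "F = (\<lambda>(p::complex\<times>complex) s. f (fst p, snd p + s))"
  have near: "\<forall>\<^sub>F p in at q. dist p q < e" if "e > 0" for e
    using that unfolding eventually_at by blast
  have mem: "fst p \<in> cball a r \<and> snd p + s \<in> cball b r" if "dist p q < r / 2" "s \<in> ball 0 (r/2)" for p s
  proof -
    have "dist (fst p) a < r/2" "dist (snd p) b < r/2"
      using that(1) q dist_fst_le[of p q] dist_snd_le[of p q] by auto
    moreover have "dist (snd p + s) b \<le> norm s + dist (snd p) b"
      using norm_triangle_ineq[of s "snd p - b"] by (simp add: dist_norm algebra_simps)
    ultimately show ?thesis using that(2) r(1) by (auto simp: dist_commute)
  qed
  have "uniform_limit (ball 0 (r/2)) F (F q) (at q)"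
    unfolding uniform_limit_iff
  proof safe
    fix e :: real assume "e > 0"
    then obtain d where d: "d > 0"
      "\<And>x y. x \<in> cball a r \<times> cball b r \<Longrightarrow> y \<in> cball a r \<times> cball b r \<Longrightarrow> dist x y < d \<Longrightarrow> dist (f x) (f y) < e"
      using uc unfolding uniformly_continuous_on_def by metis
    have "\<forall>\<^sub>F p in at q. dist p q < min d (r/2)" using near[of "min d (r/2)"] d r by simp
    then show "\<forall>\<^sub>F p in at q. \<forall>s\<in>ball 0 (r/2). dist (F p s) (F q s) < e"
    proof eventually_elim
      case (elim p)
      have "dist (fst p, snd p + s) (fst q, snd q + s) = dist p q" for s
        by (simp add: dist_prod_def)
      then show ?case using mem[of p] mem[of q] elim r(1)
        unfolding F_def by (auto intro!: d)
    qed
  qed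
  moreover have "\<forall>\<^sub>F p in at q. F p holomorphic_on ball 0 (r/2)"
    using near[of "r/2", OF half_gt_zero[OF r(1)]]
  proof eventually_elim
    case (elim p)
    show ?case unfolding holomorphic_on_open[OF open_ball]
    proof safe
      fix s :: complex assume s: "s \<in> ball 0 (r/2)"
      have "(fst p, snd p + s) \<in> U" using mem[OF elim s] r by auto
      from separately_holomorphic_on_DERIV(2)[OF h this]
      have "(F p has_field_derivative Du f (fst p, snd p + s)) (at s)"
        unfolding F_def using DERIV_shift[of "\<lambda>s. f (fst p, s)" _ s "snd p"] by (simp add: add.commute)
      then show "\<exists>f'. (F p has_field_derivative f') (at s)" by blast
    qed
  qed
  ultimately have "((\<lambda>p. deriv (F p) 0) \<longlongrightarrow> deriv (F q) 0) (at q)"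
    using r by (intro deriv_complex_uniform_limit[where A = "ball 0 (r/2)"]) auto
  moreover have "deriv (F p) 0 = Du f p" for p
    unfolding F_def Du_def deriv_def using DERIV_shift[of "\<lambda>s. f (fst p, s)" _ 0 "snd p"]
    by (simp add: add.commute)
  ultimately show "isCont (Du f) q" by (simp add: isCont_def)
qed


lemma continuous_on_Dx:
  assumes U: "open U" and f: "continuous_on U f" and h: "separately_holomorphic_on f U"
  shows "continuous_on U (Dx f)"
proof -
  have c: "continuous_on S (prod.swap :: complex \<times> complex \<Rightarrow> _)" for S
    by (simp add: prod.swap_def[abs_def] continuous_on_Pair continuous_on_fst continuous_on_snd)
  have im: "prod.swap ` prod.swap ` U = U" by (simp add: image_image)
  have "continuous_on (prod.swap ` U) (Du (f \<circ> prod.swap))"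
    using open_swap_image[OF U] h
    by (intro continuous_on_Du continuous_on_compose c)
       (simp_all add: im f separately_holomorphic_on_swap)
  then have "continuous_on U (Du (f \<circ> prod.swap) \<circ> prod.swap)"
    by (rule continuous_on_compose[OF c])
  also have "Du (f \<circ> prod.swap) \<circ> prod.swap = Dx f" by (simp add: fun_eq_iff Du_swap)
  finally show ?thesis .
qed

text \<open>The difference quotients \<open>Q k\<close> of \<open>f\<close> in the second variable
  are holomorphic in the first and converge uniformly to \<open>Du f\<close>. Differentiating under
  this limit yields both mixed derivatives at once, with a common value; no second derivative is
  presupposed.\<close>

lemma mixed_partials_exist:
  assumes U: "open U" and f: "continuous_on U f" and h: "separately_holomorphic_on f U"
    and xu: "(x, u) \<in> U"
  obtains D where "((\<lambda>s. Du f (s, u)) has_field_derivative D) (at x)"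
    and "((\<lambda>s. Dx f (x, s)) has_field_derivative D) (at u)"
proof -
  obtain r where r: "r > 0" "cball x r \<times> cball u r \<subseteq> U"
    using cball_times_cball_subset[OF U xu] by metis
  have U': "(s, t) \<in> U" if "s \<in> cball x r" "t \<in> cball u r" for s t using r that by blast
  have uc: "uniformly_continuous_on (cball x r \<times> cball u r) (Du f)"
    by (intro compact_uniformly_continuous continuous_on_subset[OF continuous_on_Du[OF U f h]]
        r compact_Times compact_cball)
  define Q where "Q = (\<lambda>k s. (f (s, u + k) - f (s, u)) / k)"
  have near: "\<forall>\<^sub>F k in at (0::complex). k \<noteq> 0 \<and> norm k < e" if "e > 0" for e
    using that unfolding eventually_at by (auto intro!: exI[of _ e])
  have ul: "uniform_limit (cball x r) Q (\<lambda>s. Du f (s, u)) (at 0)"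
    unfolding uniform_limit_iff
  proof safe
    fix e :: real assume e: "e > 0"
    then obtain d where d: "d > 0"
      "\<And>p q. p \<in> cball x r \<times> cball u r \<Longrightarrow> q \<in> cball x r \<times> cball u r \<Longrightarrow> dist p q < d
         \<Longrightarrow> dist (Du f p) (Du f q) < e / 2"
      using uc half_gt_zero[OF e] unfolding uniformly_continuous_on_def by metis
    have "\<forall>\<^sub>F k in at (0::complex). k \<noteq> 0 \<and> norm k < min d r" using near[of "min d r"] d r by simp
    then show "\<forall>\<^sub>F k in at 0. \<forall>s\<in>cball x r. dist (Q k s) (Du f (s, u)) < e"
    proof eventually_elim
      case (elim k)
      show ?case
      proof
        fix s assume s: "s \<in> cball x r"
        \<comment> \<open>Mean value inequality for \<open>f (s, t) - t * Du f (s, u)\<close> as a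
          function of \<open>t\<close>. Its derivative is small by uniform continuity of
          \<open>Du f\<close>, with a bound that does not depend on \<open>s\<close>.\<close>
        have "norm ((f (s, u + k) - (u + k) * Du f (s, u)) - (f (s, u) - u * Du f (s, u)))
            \<le> e / 2 * norm ((u + k) - u)"
        proof (rule field_differentiable_bound[OF convex_cball[of u "norm k"]])
          fix t assume t: "t \<in> cball u (norm k)"
          then have t': "t \<in> cball u r" using elim by auto
          have "((\<lambda>t. f (s, t) - t * Du f (s, u)) has_field_derivative (Du f (s, t) - Du f (s, u))) (at t)"
            by (rule derivative_eq_intros separately_holomorphic_on_DERIV(2)[OF h U'[OF s t']] refl | simp)+
          then show "((\<lambda>t. f (s, t) - t * Du f (s, u)) has_field_derivative (Du f (s, t) - Du f (s, u)))
              (at t within cball u (norm k))"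
            by (rule has_field_derivative_at_within)
          have "dist (s, t) (s, u) < d" using t elim by (simp add: dist_prod_def dist_commute)
          with d(2)[of "(s, t)" "(s, u)"] s t' r(1)
          show "norm (Du f (s, t) - Du f (s, u)) \<le> e / 2" by (simp add: dist_norm)
        qed (auto simp: dist_norm)
        then have "norm (f (s, u + k) - f (s, u) - k * Du f (s, u)) \<le> e / 2 * norm k"
          by (simp add: algebra_simps)
        moreover have "f (s, u + k) - f (s, u) - k * Du f (s, u) = k * (Q k s - Du f (s, u))"
          using elim by (simp add: Q_def field_simps)
        ultimately have "norm k * norm (Q k s - Du f (s, u)) \<le> norm k * (e / 2)"
          by (simp add: norm_mult mult.commute)
        then have "norm (Q k s - Du f (s, u)) \<le> e / 2" using elim by simp
        then show "dist (Q k s) (Du f (s, u)) < e" using e by (simp add: dist_norm)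
      qed
    qed
  qed
  have ev: "\<forall>\<^sub>F k in at 0. continuous_on (cball x r) (Q k) \<and>
      (\<forall>s\<in>ball x r. (Q k has_field_derivative (Dx f (s, u + k) - Dx f (s, u)) / k) (at s))"
    using near[OF r(1)]
  proof eventually_elim
    case (elim k)
    have *: "(Q k has_field_derivative (Dx f (s, u + k) - Dx f (s, u)) / k) (at s)" if "s \<in> cball x r" for s
    proof -
      have "(s, u + k) \<in> U" "(s, u) \<in> U" using elim that r(1) by (auto intro!: U' simp: dist_norm)
      note der = this[THEN separately_holomorphic_on_DERIV(1)[OF h]]
      show ?thesis unfolding Q_def by (intro DERIV_cdivide DERIV_diff der)
    qed
    then have "continuous_on (cball x r) (Q k)"
      by (meson DERIV_isCont continuous_at_imp_continuous_on)
    with * show ?case by auto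
  qed
  \<comment> \<open>The derivatives of \<open>Q k\<close> are the difference quotients of
    \<open>Dx f\<close> in the second variable, so their limit \<open>g' w\<close> is at the same
    time the derivative of \<open>Dx f\<close> in that variable.\<close>
  obtain g' where g': "\<And>w. w \<in> ball x r \<Longrightarrow> ((\<lambda>s. Du f (s, u)) has_field_derivative g' w) (at w) \<and>
      ((\<lambda>k. (Dx f (w, u + k) - Dx f (w, u)) / k) \<longlongrightarrow> g' w) (at 0)"
    by (rule has_complex_derivative_uniform_limit[OF ev ul _ r(1)]) auto
  show thesis using g'[of x] r(1) by (intro that[of "g' x"]) (auto simp: DERIV_def)
qed

text \<open>Both partial derivatives exist and \<open>Du f\<close> is continuous by
  \<open>continuous_on_Du\<close>. One continuous partial derivative is enough for Frechet
  differentiability.\<close>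

lemma analytic2_on_osgood:
  assumes U: "open U" and f: "continuous_on U f" and h: "separately_holomorphic_on f U"
  shows "analytic2_on f U"
  unfolding analytic2_on_def
proof
  fix q assume "q \<in> U"
  obtain x u where q: "q = (x, u)" by (cases q)
  then obtain r where r: "r > 0" "cball x r \<times> cball u r \<subseteq> U"
    using cball_times_cball_subset[OF U] \<open>q \<in> U\<close> by metis
  have U': "(s, t) \<in> U" if "s \<in> ball x r" "t \<in> ball u r" for s t using r that by force
  have "((\<lambda>(s, t). f (s, t)) has_derivative
      (\<lambda>(a, b). Dx f (x, u) * a + blinfun_apply (blinfun_mult_right (Du f (x, u))) b))
      (at (x, u) within ball x r \<times> ball u r)"
  proof (rule has_derivative_partialsI)
    show "((\<lambda>s. f (s, u)) has_derivative (\<lambda>h. Dx f (x, u) * h)) (at x within ball x r)"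
      using separately_holomorphic_on_DERIV(1)[OF h, of x u] \<open>q \<in> U\<close> q
      by (simp add: has_field_derivative_def has_derivative_at_withinI)
    show "((\<lambda>t. f (s, t)) has_derivative blinfun_apply (blinfun_mult_right (Du f (s, t))))
        (at t within ball u r)" if "s \<in> ball x r" "t \<in> ball u r" for s t
      using separately_holomorphic_on_DERIV(2)[OF h U'[OF that]]
      by (simp add: has_field_derivative_def has_derivative_at_withinI blinfun_mult_right.rep_eq)
    have "isCont (Du f) (x, u)"
      using continuous_on_Du[OF U f h] U \<open>q \<in> U\<close> q by (simp add: continuous_on_eq_continuous_at)
    then have "isCont (\<lambda>p. blinfun_mult_right (Du f p)) (x, u)"
      by (rule bounded_linear.continuous[OF bounded_linear_blinfun_mult_right])
    then show "continuous (at (x, u) within ball x r \<times> ball u r)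
        (\<lambda>(s, t). blinfun_mult_right (Du f (s, t)))"
      by (simp add: case_prod_unfold continuous_at_imp_continuous_at_within)
  qed (use r in auto)
  moreover have "at (x, u) within ball x r \<times> ball u r = at (x, u)"
    using r(1) by (intro at_within_open open_Times) auto
  ultimately show "\<exists>fx fu. (f has_derivative (\<lambda>(h, k). fx * h + fu * k)) (at q)"
    unfolding q by (auto simp: blinfun_mult_right.rep_eq)
qed

text \<open>Restricting the derivative to the two coordinate lines identifies the coefficients that
  the definition leaves existential.\<close>

lemma analytic2_on_has_derivative:
  assumes "analytic2_on f U" "p \<in> U"
  shows "(f has_derivative (\<lambda>(h, k). Dx f p * h + Du f p * k)) (at p)"
proof -
  obtain fx fu where d: "(f has_derivative (\<lambda>(h, k). fx * h + fu * k)) (at p)"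
    using assms unfolding analytic2_on_def by blast
  obtain x u where p: "p = (x, u)" by (cases p)
  have "((\<lambda>s. f (s, u)) has_derivative (\<lambda>h. (\<lambda>(h, k). fx * h + fu * k) (h, 0))) (at x)"
    by (rule has_derivative_compose[of "\<lambda>s. (s, u)" "\<lambda>h. (h, 0)" x UNIV f, OF _ d[unfolded p]])
       (auto intro!: derivative_eq_intros)
  moreover have "((\<lambda>s. f (x, s)) has_derivative (\<lambda>h. (\<lambda>(h, k). fx * h + fu * k) (0, h))) (at u)"
    by (rule has_derivative_compose[of "\<lambda>s. (x, s)" "\<lambda>h. (0, h)" u UNIV f, OF _ d[unfolded p]])
       (auto intro!: derivative_eq_intros)
  ultimately have "((\<lambda>s. f (s, u)) has_field_derivative fx) (at x)"
      "((\<lambda>s. f (x, s)) has_field_derivative fu) (at u)"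
    by (simp_all add: has_field_derivative_def)
  then have "Dx f p = fx" "Du f p = fu" by (simp_all add: p Dx_def Du_def DERIV_imp_deriv)
  with d show ?thesis by simp
qed

lemma analytic2_on_imp_continuous_on: "analytic2_on f U \<Longrightarrow> continuous_on U f"
  by (meson analytic2_on_has_derivative continuous_at_imp_continuous_on has_derivative_continuous)

lemma analytic2_on_DERIV_curve:
  assumes f: "analytic2_on f U" and "(\<alpha> t, \<beta> t) \<in> U"
    and "(\<alpha> has_field_derivative \<alpha>') (at t)" "(\<beta> has_field_derivative \<beta>') (at t)"
  shows "((\<lambda>s. f (\<alpha> s, \<beta> s)) has_field_derivative
      Dx f (\<alpha> t, \<beta> t) * \<alpha>' + Du f (\<alpha> t, \<beta> t) * \<beta>') (at t)"
proof -
  have "((\<lambda>s. f (\<alpha> s, \<beta> s)) has_derivative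
      (\<lambda>h. (\<lambda>(h, k). Dx f (\<alpha> t, \<beta> t) * h + Du f (\<alpha> t, \<beta> t) * k) (\<alpha>' * h, \<beta>' * h))) (at t)"
    by (rule has_derivative_compose[of "\<lambda>s. (\<alpha> s, \<beta> s)" _ t UNIV f,
          OF _ analytic2_on_has_derivative[OF f assms(2)]])
       (use assms(3,4) in \<open>auto intro!: has_derivative_Pair simp: has_field_derivative_def\<close>)
  moreover have "(\<lambda>h. (\<lambda>(h, k). Dx f (\<alpha> t, \<beta> t) * h + Du f (\<alpha> t, \<beta> t) * k) (\<alpha>' * h, \<beta>' * h))
      = (*) (Dx f (\<alpha> t, \<beta> t) * \<alpha>' + Du f (\<alpha> t, \<beta> t) * \<beta>')"
    by (auto simp: fun_eq_iff algebra_simps)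
  ultimately show ?thesis by (simp only: has_field_derivative_def)
qed

lemma analytic2_on_imp_separately_holomorphic_on:
  assumes "analytic2_on f U" shows "separately_holomorphic_on f U"
  unfolding separately_holomorphic_on_def
proof
  fix p assume p: "p \<in> U"
  show "(\<lambda>s. f (s, snd p)) field_differentiable at (fst p) \<and>
     (\<lambda>s. f (fst p, s)) field_differentiable at (snd p)"
    using analytic2_on_DERIV_curve[OF assms, of "\<lambda>s. s" "fst p" "\<lambda>_. snd p" 1 0]
      analytic2_on_DERIV_curve[OF assms, of "\<lambda>_. fst p" "snd p" "\<lambda>s. s" 0 1] p
    by (auto simp: field_differentiable_def)
qed

text \<open>The first derivatives are continuous and again separately holomorphic: in their own
  variable by one-variable theory, in the other one by \<open>mixed_partials_exist\<close>. Osgood's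
  lemma then applies to them.\<close>

lemma
  assumes U: "open U" and f: "analytic2_on f U"
  shows analytic2_on_Dx: "analytic2_on (Dx f) U" and analytic2_on_Du: "analytic2_on (Du f) U"
    and Dx_Du_commute: "p \<in> U \<Longrightarrow> Dx (Du f) p = Du (Dx f) p"
proof -
  note c = analytic2_on_imp_continuous_on[OF f] and h = analytic2_on_imp_separately_holomorphic_on[OF f]
  have mixed: "\<exists>D. ((\<lambda>s. Du f (s, snd p)) has_field_derivative D) (at (fst p)) \<and>
      ((\<lambda>s. Dx f (fst p, s)) has_field_derivative D) (at (snd p))" if "p \<in> U" for p
    using mixed_partials_exist[OF U c h, of "fst p" "snd p"] that by auto
  then show "p \<in> U \<Longrightarrow> Dx (Du f) p = Du (Dx f) p"
    unfolding Dx_def[of "Du f"] Du_def[of "Dx f"] by (metis DERIV_imp_deriv)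
  have pure: "(\<lambda>s. Dx f (s, snd p)) field_differentiable at (fst p)"
      "(\<lambda>s. Du f (fst p, s)) field_differentiable at (snd p)" if "p \<in> U" for p
  proof -
    obtain r where r: "r > 0" "cball (fst p) r \<times> cball (snd p) r \<subseteq> U"
      using cball_times_cball_subset[OF U, of "fst p" "snd p"] \<open>p \<in> U\<close> by auto
    then have U': "(s, snd p) \<in> U" "(fst p, t) \<in> U" if "s \<in> ball (fst p) r" "t \<in> ball (snd p) r" for s t
      using that by auto
    have "(\<lambda>s. f (s, snd p)) holomorphic_on ball (fst p) r" "(\<lambda>s. f (fst p, s)) holomorphic_on ball (snd p) r"
      unfolding holomorphic_on_open[OF open_ball]
      using separately_holomorphic_on_DERIV(1)[OF h U'(1)] separately_holomorphic_on_DERIV(2)[OF h U'(2)]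
        centre_in_ball r(1) by blast+
    from this[THEN holomorphic_deriv[OF _ open_ball]]
    show "(\<lambda>s. Dx f (s, snd p)) field_differentiable at (fst p)"
      "(\<lambda>s. Du f (fst p, s)) field_differentiable at (snd p)"
      unfolding Dx_def Du_def fst_conv snd_conv
      using r(1) by (simp_all add: holomorphic_on_imp_differentiable_at[OF _ open_ball])
  qed
  have mixed': "(\<lambda>s. Dx f (fst p, s)) field_differentiable at (snd p)"
      "(\<lambda>s. Du f (s, snd p)) field_differentiable at (fst p)" if "p \<in> U" for p
    using mixed[OF that] by (auto simp: field_differentiable_def)
  show "analytic2_on (Dx f) U" "analytic2_on (Du f) U"
    using mixed' pure U continuous_on_Dx[OF U c h] continuous_on_Du[OF U c h]
    by (auto intro!: analytic2_on_osgood simp: separately_holomorphic_on_def)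
qed

section \<open>Closure of analytic functions under algebraic operations and determinants\<close>

lemma analytic2_on_const [intro]: "analytic2_on (\<lambda>_. c) U"
  unfolding analytic2_on_def by (auto intro!: exI[of _ 0] simp: case_prod_unfold)

lemma analytic2_on_add [intro]:
  assumes "analytic2_on f U" "analytic2_on g U" shows "analytic2_on (\<lambda>p. f p + g p) U"
  unfolding analytic2_on_def
proof
  fix p assume p: "p \<in> U"
  have "((\<lambda>p. f p + g p) has_derivative (\<lambda>h. (case h of (h, k) \<Rightarrow> Dx f p * h + Du f p * k) +
      (case h of (h, k) \<Rightarrow> Dx g p * h + Du g p * k))) (at p)"
    by (intro has_derivative_add analytic2_on_has_derivative[OF _ p] assms)
  also have "(\<lambda>h. (case h of (h, k) \<Rightarrow> Dx f p * h + Du f p * k) +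
      (case h of (h, k) \<Rightarrow> Dx g p * h + Du g p * k)) = (\<lambda>(h, k). (Dx f p + Dx g p) * h + (Du f p + Du g p) * k)"
    by (auto simp: fun_eq_iff algebra_simps)
  finally show "\<exists>fx fu. ((\<lambda>p. f p + g p) has_derivative (\<lambda>(h, k). fx * h + fu * k)) (at p)" by blast
qed

lemma analytic2_on_mult [intro]:
  assumes "analytic2_on f U" "analytic2_on g U" shows "analytic2_on (\<lambda>p. f p * g p) U"
  unfolding analytic2_on_def
proof
  fix p assume p: "p \<in> U"
  have "((\<lambda>p. f p * g p) has_derivative (\<lambda>h. f p * (case h of (h, k) \<Rightarrow> Dx g p * h + Du g p * k) +
      (case h of (h, k) \<Rightarrow> Dx f p * h + Du f p * k) * g p)) (at p)"
    by (intro has_derivative_mult analytic2_on_has_derivative[OF _ p] assms)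
  also have "(\<lambda>h. f p * (case h of (h, k) \<Rightarrow> Dx g p * h + Du g p * k) +
      (case h of (h, k) \<Rightarrow> Dx f p * h + Du f p * k) * g p) =
      (\<lambda>(h, k). (f p * Dx g p + Dx f p * g p) * h + (f p * Du g p + Du f p * g p) * k)"
    by (auto simp: fun_eq_iff algebra_simps)
  finally show "\<exists>fx fu. ((\<lambda>p. f p * g p) has_derivative (\<lambda>(h, k). fx * h + fu * k)) (at p)" by blast
qed

lemma analytic2_on_uminus [intro]: "analytic2_on f U \<Longrightarrow> analytic2_on (\<lambda>p. - f p) U"
  using analytic2_on_mult[OF analytic2_on_const[of "-1"]] by fastforce

lemma analytic2_on_diff [intro]:
  "analytic2_on f U \<Longrightarrow> analytic2_on g U \<Longrightarrow> analytic2_on (\<lambda>p. f p - g p) U"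
  using analytic2_on_add[OF _ analytic2_on_uminus, of f U g] by simp

lemma analytic2_on_inverse:
  assumes "analytic2_on f U" "\<And>p. p \<in> U \<Longrightarrow> f p \<noteq> 0" shows "analytic2_on (\<lambda>p. inverse (f p)) U"
  unfolding analytic2_on_def
proof
  fix p assume p: "p \<in> U"
  have "((\<lambda>p. inverse (f p)) has_derivative (\<lambda>h. - (inverse (f p) *
      (case h of (h, k) \<Rightarrow> Dx f p * h + Du f p * k) * inverse (f p)))) (at p)"
    by (intro Deriv.has_derivative_inverse analytic2_on_has_derivative[OF _ p] assms p)
  also have "(\<lambda>h. - (inverse (f p) * (case h of (h, k) \<Rightarrow> Dx f p * h + Du f p * k) * inverse (f p))) =
      (\<lambda>(h, k). (- inverse (f p) * Dx f p * inverse (f p)) * h +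
          (- inverse (f p) * Du f p * inverse (f p)) * k)"
    by (auto simp: fun_eq_iff algebra_simps)
  finally show "\<exists>fx fu. ((\<lambda>p. inverse (f p)) has_derivative (\<lambda>(h, k). fx * h + fu * k)) (at p)" by blast
qed

lemma analytic2_on_divide:
  "analytic2_on f U \<Longrightarrow> analytic2_on g U \<Longrightarrow> (\<And>p. p \<in> U \<Longrightarrow> g p \<noteq> 0) \<Longrightarrow>
    analytic2_on (\<lambda>p. f p / g p) U"
  unfolding divide_inverse by (intro analytic2_on_mult analytic2_on_inverse)

lemma analytic2_on_sum [intro]:
  "(\<And>i. i \<in> I \<Longrightarrow> analytic2_on (f i) U) \<Longrightarrow> analytic2_on (\<lambda>p. \<Sum>i\<in>I. f i p) U"
  by (induction I rule: infinite_finite_induct) auto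

lemma analytic2_on_prod [intro]:
  "(\<And>i. i \<in> I \<Longrightarrow> analytic2_on (f i) U) \<Longrightarrow> analytic2_on (\<lambda>p. \<Prod>i\<in>I. f i p) U"
  by (induction I rule: infinite_finite_induct) auto

lemma analytic2_on_subset: "analytic2_on f U \<Longrightarrow> V \<subseteq> U \<Longrightarrow> analytic2_on f V"
  unfolding analytic2_on_def by blast

lemma analytic2_on_det:
  "(\<And>i j. analytic2_on (\<lambda>p. A p $ i $ j) U) \<Longrightarrow> analytic2_on (\<lambda>p. det (A p)) U"
  unfolding det_def by (intro analytic2_on_sum analytic2_on_mult analytic2_on_const analytic2_on_prod)

lemma vec_analytic2_on_subset: "vec_analytic2_on f U \<Longrightarrow> V \<subseteq> U \<Longrightarrow> vec_analytic2_on f V"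
  unfolding vec_analytic2_on_def using analytic2_on_subset by blast

lemma vec_analytic2_on_add [intro]:
  "vec_analytic2_on f U \<Longrightarrow> vec_analytic2_on g U \<Longrightarrow> vec_analytic2_on (\<lambda>p. f p + g p) U"
  by (auto simp: vec_analytic2_on_def)

lemma vec_analytic2_on_scale [intro]:
  "analytic2_on c U \<Longrightarrow> vec_analytic2_on f U \<Longrightarrow> vec_analytic2_on (\<lambda>p. c p *s f p) U"
  by (auto simp: vec_analytic2_on_def)

section \<open>Vector-valued functions and their derivatives along curves\<close>

lemma partial_x_nth: "partial_x f p $ i = Dx (\<lambda>p. f p $ i) p"
  and partial_u_nth: "partial_u f p $ i = Du (\<lambda>p. f p $ i) p"
  by (simp_all add: partial_x_def partial_u_def vec_deriv_def Dx_def Du_def)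

lemma vec_analytic2_on_partial:
  assumes "open U" "vec_analytic2_on f U"
  shows "vec_analytic2_on (partial_x f) U" and "vec_analytic2_on (partial_u f) U"
  using assms unfolding vec_analytic2_on_def partial_x_nth partial_u_nth
  by (auto intro: analytic2_on_Dx analytic2_on_Du)

lemma partial_x_partial_u:
  assumes "open U" "vec_analytic2_on f U" "p \<in> U"
  shows "partial_x (partial_u f) p = partial_u (partial_x f) p"
  using assms unfolding vec_analytic2_on_def
  by (simp add: vec_eq_iff partial_x_nth partial_u_nth Dx_Du_commute)

lemma DERIV_vec_curve:
  assumes y: "vec_analytic2_on y U" and "(t, f t) \<in> U" "(f has_field_derivative m) (at t)"
  shows "((\<lambda>t. y (t, f t) $ i) has_field_derivative
      partial_x y (t, f t) $ i + m * partial_u y (t, f t) $ i) (at t)"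
  using analytic2_on_DERIV_curve[of "\<lambda>p. y p $ i" U "\<lambda>s. s" t f 1 m] assms
  by (auto simp: vec_analytic2_on_def partial_x_nth partial_u_nth mult.commute)

lemma vec_deriv_curve:
  assumes "vec_analytic2_on y U" "(t, f t) \<in> U" "(f has_field_derivative m) (at t)"
  shows "vec_deriv (\<lambda>t. y (t, f t)) t = partial_x y (t, f t) + m *s partial_u y (t, f t)"
  using DERIV_imp_deriv[OF DERIV_vec_curve[OF assms]] by (simp add: vec_deriv_def vec_eq_iff)

text \<open>The chain rule is applied twice; the factor 2 comes from the symmetry of the mixed
  derivatives. The second derivative of \<open>f\<close> multiplies only the vector
  \<open>partial_u y\<close>, which is why the final equation is linear in it.\<close>

lemma vec_deriv_vec_deriv_curve:
  assumes U: "open U" and y: "vec_analytic2_on y U" and W: "open W" and f: "f holomorphic_on W"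
    and g: "\<And>x. x \<in> W \<Longrightarrow> (x, f x) \<in> U" and t: "t \<in> W"
  shows "vec_deriv (vec_deriv (\<lambda>t. y (t, f t))) t =
    partial_x (partial_x y) (t, f t) + (2 * deriv f t) *s partial_u (partial_x y) (t, f t)
    + (deriv f t)\<^sup>2 *s partial_u (partial_u y) (t, f t) + deriv (deriv f) t *s partial_u y (t, f t)"
proof -
  have df: "(f has_field_derivative deriv f s) (at s)" if "s \<in> W" for s
    using holomorphic_derivI[OF f W that] .
  have ddf: "(deriv f has_field_derivative deriv (deriv f) t) (at t)"
    using holomorphic_derivI[OF holomorphic_deriv[OF f W] W t] .
  note yx = vec_analytic2_on_partial(1)[OF U y] and yu = vec_analytic2_on_partial(2)[OF U y]
  have "deriv (\<lambda>s. vec_deriv (\<lambda>t. y (t, f t)) s $ i) t =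
    partial_x (partial_x y) (t, f t) $ i + deriv f t * partial_u (partial_x y) (t, f t) $ i +
    (deriv f t * (partial_x (partial_u y) (t, f t) $ i + deriv f t * partial_u (partial_u y) (t, f t) $ i)
     + deriv (deriv f) t * partial_u y (t, f t) $ i)" for i
  proof -
    have "((\<lambda>s. partial_x y (s, f s) $ i + deriv f s * partial_u y (s, f s) $ i) has_field_derivative
      partial_x (partial_x y) (t, f t) $ i + deriv f t * partial_u (partial_x y) (t, f t) $ i +
    (deriv f t * (partial_x (partial_u y) (t, f t) $ i + deriv f t * partial_u (partial_u y) (t, f t) $ i)
     + deriv (deriv f) t * partial_u y (t, f t) $ i)) (at t)"
      by (intro DERIV_add DERIV_mult' DERIV_vec_curve[OF yx] DERIV_vec_curve[OF yu] g t df ddf)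
    then have "((\<lambda>s. vec_deriv (\<lambda>t. y (t, f t)) s $ i) has_field_derivative
      partial_x (partial_x y) (t, f t) $ i + deriv f t * partial_u (partial_x y) (t, f t) $ i +
    (deriv f t * (partial_x (partial_u y) (t, f t) $ i + deriv f t * partial_u (partial_u y) (t, f t) $ i)
     + deriv (deriv f) t * partial_u y (t, f t) $ i)) (at t)"
      by (rule has_field_derivative_transform_within_open[OF _ W t])
         (simp add: vec_deriv_curve[OF y g df])
    then show ?thesis by (rule DERIV_imp_deriv)
  qed
  then show ?thesis
    unfolding vec_deriv_def[of "vec_deriv _"]
    by (simp add: vec_eq_iff partial_x_partial_u[OF U y g[OF t]] power2_eq_square algebra_simps)
qed

section \<open>Determinants of five vectors\<close>

lemma exhaust_5:
  fixes x :: 5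
  shows "x = 0 \<or> x = 1 \<or> x = 2 \<or> x = 3 \<or> x = 4"
proof (induct x)
  case (of_int z)
  then have "z = 0 \<or> z = 1 \<or> z = 2 \<or> z = 3 \<or> z = 4" by fastforce
  then show ?case by auto
qed

lemma UNIV_5: "UNIV = {0, 1, 2, 3, 4 :: 5}"
  using exhaust_5 by auto

section \<open>Multilinearity and alternation of the determinant of five vectors\<close>

lemma det_row_add_gen:
  fixes A B C :: "'a::comm_ring_1^'n^'n"
  assumes "\<And>i. i \<noteq> k \<Longrightarrow> B $ i = A $ i" "\<And>i. i \<noteq> k \<Longrightarrow> C $ i = A $ i" "A $ k = B $ k + C $ k"
  shows "det A = det B + det C"
proof -
  have "A = (\<chi> i. if i = k then B $ i + C $ i else A $ i)"
    "B = (\<chi> i. if i = k then B $ i else A $ i)" "C = (\<chi> i. if i = k then C $ i else A $ i)"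
    using assms by (auto simp: vec_eq_iff)
  then show ?thesis using det_row_add[of k "($) B" "($) C" "($) A"] by metis
qed

lemma det_row_mul_gen:
  fixes A B :: "'a::comm_ring_1^'n^'n"
  assumes "\<And>i. i \<noteq> k \<Longrightarrow> B $ i = A $ i" "A $ k = c *s B $ k"
  shows "det A = c * det B"
proof -
  have "A = (\<chi> i. if i = k then c *s B $ i else A $ i)"
    "B = (\<chi> i. if i = k then B $ i else A $ i)"
    using assms by (auto simp: vec_eq_iff)
  then show ?thesis using det_row_mul[of k c "($) B" "($) A"] by metis
qed

definition list5 :: "'a \<Rightarrow> 'a \<Rightarrow> 'a \<Rightarrow> 'a \<Rightarrow> 'a \<Rightarrow> 5 \<Rightarrow> 'a" where
  "list5 a b c d e i = (if i = 0 then a else if i = 1 then b else if i = 2 then c else if i = 3 then d else e)"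

lemma list5_simps [simp]:
  "list5 a b c d e 0 = a" "list5 a b c d e 1 = b" "list5 a b c d e 2 = c"
  "list5 a b c d e 3 = d" "list5 a b c d e 4 = e"
  by (simp_all add: list5_def)

lemma range_list5: "range (list5 a b c d e) = {a, b, c, d, e}"
  unfolding UNIV_5 by simp

text \<open>The surface may lie in a space of higher dimension. The matrix \<open>N\<close> projects
  to five coordinates, so that vectors of the five-dimensional space S(2,0) have a determinant; a
  constant \<open>N\<close> keeps it analytic in the point.\<close>

definition det5 :: "complex ^ 'n ^ 5 \<Rightarrow> complex ^ 'n \<Rightarrow> complex ^ 'n \<Rightarrow> complex ^ 'n \<Rightarrow> complex ^ 'n \<Rightarrow> complex ^ 'n \<Rightarrow> complex" where
  "det5 N a b c d e = det (\<chi> i. N *v list5 a b c d e i)"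

lemma det5_add:
  "det5 N (a + a') b c d e = det5 N a b c d e + det5 N a' b c d e"
  "det5 N a (b + b') c d e = det5 N a b c d e + det5 N a b' c d e"
  "det5 N a b (c + c') d e = det5 N a b c d e + det5 N a b c' d e"
  "det5 N a b c (d + d') e = det5 N a b c d e + det5 N a b c d' e"
  "det5 N a b c d (e + e') = det5 N a b c d e + det5 N a b c d e'"
  unfolding det5_def
  subgoal by (rule det_row_add_gen[where k = 0]) (auto simp: list5_def matrix_vector_right_distrib)
  subgoal by (rule det_row_add_gen[where k = 1]) (auto simp: list5_def matrix_vector_right_distrib)
  subgoal by (rule det_row_add_gen[where k = 2]) (auto simp: list5_def matrix_vector_right_distrib)
  subgoal by (rule det_row_add_gen[where k = 3]) (auto simp: list5_def matrix_vector_right_distrib)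
  \<comment> \<open>The last entry of \<open>list5\<close> is the default branch, so an index
    different from 4 has to be resolved to 0, 1, 2 or 3 by \<open>exhaust_5\<close>.\<close>
  subgoal by (rule det_row_add_gen[where k = 4])
      (use exhaust_5 in \<open>force simp: list5_def matrix_vector_right_distrib\<close>)+
  done

lemma det5_scale:
  "det5 N (k *s a) b c d e = k * det5 N a b c d e"
  "det5 N a (k *s b) c d e = k * det5 N a b c d e"
  "det5 N a b (k *s c) d e = k * det5 N a b c d e"
  "det5 N a b c (k *s d) e = k * det5 N a b c d e"
  "det5 N a b c d (k *s e) = k * det5 N a b c d e"
  unfolding det5_def
  subgoal by (rule det_row_mul_gen[where k = 0]) (auto simp: list5_def vec.scale)
  subgoal by (rule det_row_mul_gen[where k = 1]) (auto simp: list5_def vec.scale)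
  subgoal by (rule det_row_mul_gen[where k = 2]) (auto simp: list5_def vec.scale)
  subgoal by (rule det_row_mul_gen[where k = 3]) (auto simp: list5_def vec.scale)
  subgoal by (rule det_row_mul_gen[where k = 4])
      (use exhaust_5 in \<open>force simp: list5_def vec.scale\<close>)+
  done

lemma det5_eq_0:
  assumes "i \<noteq> j" "list5 a b c d e i = list5 a b c d e j"
  shows "det5 N a b c d e = 0"
  unfolding det5_def using assms
  by (intro det_identical_rows[of i j]) (simp_all add: row_def)

lemma det5_same:
  "det5 N a a c d e = 0" "det5 N a b a d e = 0" "det5 N a b c a e = 0" "det5 N a b c d a = 0"
  "det5 N a b b d e = 0" "det5 N a b c b e = 0" "det5 N a b c d b = 0"
  "det5 N a b c c e = 0" "det5 N a b c d c = 0" "det5 N a b c d d = 0"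
  subgoal by (rule det5_eq_0[of 0 1]) auto
  subgoal by (rule det5_eq_0[of 0 2]) auto
  subgoal by (rule det5_eq_0[of 0 3]) auto
  subgoal by (rule det5_eq_0[of 0 4]) auto
  subgoal by (rule det5_eq_0[of 1 2]) auto
  subgoal by (rule det5_eq_0[of 1 3]) auto
  subgoal by (rule det5_eq_0[of 1 4]) auto
  subgoal by (rule det5_eq_0[of 2 3]) auto
  subgoal by (rule det5_eq_0[of 2 4]) auto
  subgoal by (rule det5_eq_0[of 3 4]) auto
  done

section \<open>Determinants, dimensions and the incidence of planes\<close>

lemma vec_dim_le_5: "vec.dim {a, b, c, d, e :: complex ^ 'n} \<le> 5"
proof -
  have "vec.dim {a, b, c, d, e} \<le> card {a, b, c, d, e}"
    by (rule vec.dim_le_card) (auto simp: vec.span_superset)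
  also have "card {a, b, c, d, e} \<le> 5" by (simp add: card_insert_if)
  finally show ?thesis .
qed

text \<open>A square matrix is invertible exactly when its rows span, and a linear map commutes with
  taking spans.\<close>

lemma det5_nonzero_iff_span: "det5 N a b c d e \<noteq> 0 \<longleftrightarrow> (*v) N ` vec.span {a, b, c, d, e} = UNIV"
proof -
  have "det5 N a b c d e \<noteq> 0 \<longleftrightarrow> vec.span (rows (\<chi> i. N *v list5 a b c d e i)) = UNIV"
    unfolding det5_def invertible_det_nz[symmetric] invertible_left_inverse
      matrix_left_invertible_span_rows_gen ..
  also have "rows (\<chi> i. N *v list5 a b c d e i) = (*v) N ` {a, b, c, d, e}"
    unfolding rows_def range_list5[symmetric] by (auto simp: row_def)
  also have "vec.span \<dots> = (*v) N ` vec.span {a, b, c, d, e}"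
    by (rule vec.span_image)
  finally show ?thesis .
qed

lemma dim_eq_5_if_det5:
  assumes "det5 N a b c d e \<noteq> 0" shows "vec.dim {a, b, c, d, e} = 5"
proof -
  have "5 = vec.dim (UNIV :: (complex ^ 5) set)" by (simp add: vec.dim_UNIV card_cart_basis)
  also have "UNIV = (*v) N ` vec.span {a, b, c, d, e}"
    using assms det5_nonzero_iff_span by metis
  also have "vec.dim \<dots> \<le> vec.dim {a, b, c, d, e}"
    using vec.dim_image_le[OF matrix_vector_mul_linear_gen, of N "vec.span {a, b, c, d, e}"] by simp
  finally show ?thesis using vec_dim_le_5[of a b c d e] by simp
qed

text \<open>A nonzero determinant on one quintuple makes \<open>N\<close> faithful on its span, so
  that inside this span the determinant is a genuine test of independence. Outside it,
  \<open>N\<close> could kill independent vectors.\<close>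

lemma det5_nonzero_iff_dim:
  assumes "det5 N a b c d e \<noteq> 0" and "{a', b', c', d', e'} \<subseteq> vec.span {a, b, c, d, e}"
  shows "det5 N a' b' c' d' e' \<noteq> 0 \<longleftrightarrow> vec.dim {a', b', c', d', e'} = 5"
proof
  assume "vec.dim {a', b', c', d', e'} = 5"
  then have "vec.span {a', b', c', d', e'} = vec.span {a, b, c, d, e}"
    using vec.dim_eq_span[OF assms(2)] dim_eq_5_if_det5[OF assms(1)] by (simp add: vec.span_span)
  then show "det5 N a' b' c' d' e' \<noteq> 0"
    using assms(1) by (simp add: det5_nonzero_iff_span)
qed (rule dim_eq_5_if_det5)

text \<open>Extend the assignment of the standard basis to the five independent vectors to a linear
  map; the determinant becomes that of the identity matrix.\<close>

lemma ex_det5_nonzero: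
  assumes "vec.dim {a, b, c, d, e :: complex ^ 'n} = 5"
  obtains N where "det5 N a b c d e \<noteq> 0"
proof -
  have card: "card {a, b, c, d, e} = 5"
  proof (rule antisym)
    show "card {a, b, c, d, e} \<le> 5" by (simp add: card_insert_if)
    show "5 \<le> card {a, b, c, d, e}" using vec.dim_le_card[of "{a, b, c, d, e}" "{a, b, c, d, e}"] assms
      by (simp add: vec.span_superset)
  qed
  have ind: "vec.independent {a, b, c, d, e}"
    using vec.card_le_dim_spanning[of "{a, b, c, d, e}" "{a, b, c, d, e}"] card assms
    by (auto simp: vec.span_superset)
  \<comment> \<open>Five distinct vectors determine their index, so the inverse of
    \<open>list5\<close> can name the basis vector to which each one is sent.\<close>
  have inj: "inj (list5 a b c d e)"
    using card unfolding range_list5[symmetric] by (intro eq_card_imp_inj_on) auto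
  obtain g :: "complex ^ 'n \<Rightarrow> complex ^ 5" where g: "Vector_Spaces.linear (*s) (*s) g"
    "\<forall>x\<in>{a, b, c, d, e}. g x = axis (inv (list5 a b c d e) x) 1"
    using vec.linear_independent_extend[OF ind, where f = "\<lambda>x. axis (inv (list5 a b c d e) x) 1"] by blast
  define N where "N = matrix g"
  have N: "N *v x = g x" for x unfolding N_def by (simp add: matrix_works g)
  have Ni: "N *v list5 a b c d e i = axis i 1" for i
    unfolding N using g(2) inj by (metis inv_f_f rangeI range_list5)
  have "det5 N a b c d e = det (mat 1 :: complex ^ 5 ^ 5)"
    unfolding det5_def Ni by (rule arg_cong[where f = det]) (simp add: vec_eq_iff mat_def axis_def)
  then show thesis using that[of N] by simp
qed

text \<open>Grassmann's formula: the dimensions of the sum and of the intersection add up to 3 + 3,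
  so an intersection of dimension 2 means a sum of dimension 4.\<close>

lemma meet_in_line_iff_dim:
  assumes "vec.dim {p, a, b} = 3" "vec.dim {p, c, d} = 3"
  shows "meet_in_line (vec.span {p, a, b}) (vec.span {p, c, d}) \<longleftrightarrow> vec.dim {p, a, b, c, d} = 4"
proof -
  have "{x + y |x y. x \<in> vec.span {p, a, b} \<and> y \<in> vec.span {p, c, d}} = vec.span ({p, a, b} \<union> {p, c, d})"
    unfolding vec.span_Un by blast
  moreover have "{p, a, b} \<union> {p, c, d} = {p, a, b, c, d}" by blast
  ultimately have "vec.dim {p, a, b, c, d} + vec.dim (vec.span {p, a, b} \<inter> vec.span {p, c, d}) = 6"
    using vec.dim_sums_Int[of "vec.span {p, a, b}" "vec.span {p, c, d}"] assms by simp
  then show ?thesis unfolding meet_in_line_def by linarith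
qed

lemma det5_swap: "det5 N a c b d e = - det5 N a b c d e"
proof -
  have "det5 N a (b + c) (b + c) d e = 0" by (rule det5_same)
  then show ?thesis unfolding det5_add by (simp add: det5_same eq_neg_iff_add_eq_0 add.commute)
qed

lemma det5_diff: "det5 N a b c (d - d') e = det5 N a b c d e - det5 N a b c d' e"
  using det5_add(4)[of N a b c "d - d'" d' e] by simp

lemma vec_dim_insert_le: "vec.dim (insert x S) \<le> Suc (vec.dim S)"
  by (simp add: vec.dim_insert)

lemma dim_3_le: "vec.dim {a, b, c :: complex ^ 'n} \<le> 3"
  using vec_dim_le_5[of a b c]
    vec_dim_insert_le[of a "{b, c}"] vec_dim_insert_le[of b "{c}"] vec_dim_insert_le[of c "{}"]
  by simp

text \<open>In the following \<open>h\<close> is the part of the second derivative along a curve with tangent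
  \<open>[1 : m]\<close> that does not involve \<open>u''\<close>.\<close>

lemma meet_osculating_iff_det5:
  fixes y :: "complex ^ 'n"
  assumes E: "det5 N y yx yu yxx yxu \<noteq> 0" and yuu: "yuu = a *s yx + b *s yu + c *s y"
    and vw: "{v, w} \<subseteq> vec.span {y, yx, yu, yxx, yxu}"
    and ne: "det5 N y yx yu v w \<noteq> 0"
    and h: "h = yxx + (2 * m) *s yxu + m\<^sup>2 *s yuu"
  shows "meet_in_line (vec.span {y, yx + m *s yu, h + r *s yu}) (vec.span {y, v, w}) \<longleftrightarrow>
    det5 N y (yx + m *s yu) h v w + r * det5 N y yx yu v w = 0"
proof -
  let ?g1 = "yx + m *s yu" and ?g2 = "h + r *s yu"
  let ?E = "vec.span {y, yx, yu, yxx, yxu}"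
  have mem: "{y, yx, yu, yxx, yxu} \<subseteq> ?E" by (rule vec.span_superset)
  have "vec.dim {y, yx, yxx, yu, yxu} = 5"
    using dim_eq_5_if_det5[OF E] by (simp add: insert_commute)
  \<comment> \<open>The two derivative vectors are completed to a basis by \<open>yu\<close> and
    \<open>yxu\<close>. Modulo \<open>y\<close>, \<open>yu\<close> and \<open>yxu\<close> they
    reduce to \<open>yx\<close> and \<open>yxx\<close> plus a multiple of \<open>yx\<close>, which
    shows that the osculating plane does not degenerate.\<close>
  then have "det5 N y yx yxx yu yxu \<noteq> 0"
    using det5_nonzero_iff_dim[OF E, of y yx yxx yu yxu] mem by auto
  then have "det5 N y ?g1 ?g2 yu yxu \<noteq> 0"
    by (simp add: h yuu det5_add det5_scale det5_same)
  from dim_eq_5_if_det5[OF this]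
  have 1: "vec.dim {y, ?g1, ?g2} = 3"
    using vec_dim_insert_le[of yu "{y, ?g1, ?g2, yxu}"] vec_dim_insert_le[of yxu "{y, ?g1, ?g2}"]
      dim_3_le[of y ?g1 ?g2] by (simp add: insert_commute)
  have 2: "vec.dim {y, v, w} = 3"
    using dim_eq_5_if_det5[OF ne]
      vec_dim_insert_le[of yu "{y, yx, v, w}"] vec_dim_insert_le[of yx "{y, v, w}"]
      dim_3_le[of y v w] by (simp add: insert_commute)
  have g2: "{y, ?g1, ?g2, v, w} \<subseteq> ?E"
    using mem vw unfolding h yuu by (auto intro!: vec.span_add vec.span_scale)
  \<comment> \<open>Adding a multiple of \<open>yu\<close> to \<open>yx\<close> does not change this
    determinant. It forces the sum of the two planes to have dimension at least 4, so they meet in a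
    line unless the dimension is 5.\<close>
  have "det5 N y ?g1 yu v w \<noteq> 0" using ne by (simp add: det5_add det5_scale det5_same)
  from dim_eq_5_if_det5[OF this]
  have "vec.dim {y, ?g1, v, w} \<ge> 4"
    using vec_dim_insert_le[of yu "{y, ?g1, v, w}"] by (simp add: insert_commute)
  also have "vec.dim {y, ?g1, v, w} \<le> vec.dim {y, ?g1, ?g2, v, w}"
    by (rule vec.dim_subset) auto
  finally have "vec.dim {y, ?g1, ?g2, v, w} = 4 \<longleftrightarrow> vec.dim {y, ?g1, ?g2, v, w} \<noteq> 5"
    using vec_dim_le_5[of y ?g1 ?g2 v w] by linarith
  also have "\<dots> \<longleftrightarrow> det5 N y ?g1 ?g2 v w = 0"
    using det5_nonzero_iff_dim[OF E g2] by blast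
  also have "det5 N y ?g1 ?g2 v w = det5 N y ?g1 h v w + r * det5 N y yx yu v w"
    by (simp add: det5_add det5_scale det5_same)
  finally show ?thesis unfolding meet_in_line_iff_dim[OF 1 2] .
qed

text \<open>By multilinearity the determinant is a polynomial in \<open>m\<close> of degree at most
  4. The coefficient of \<open>m ^ 4\<close> is the determinant of \<open>y, yu, yuu, v, u2\<close>;
  reducing \<open>yuu\<close> modulo \<open>y\<close> and \<open>yu\<close> turns it into
  \<open>- a\<close> times the determinant assumed to vanish.\<close>

lemma det5_osculating_cubic:
  fixes y :: "complex ^ 'n"
  assumes yuu: "yuu = a *s yx + b *s yu + c *s y" and z: "det5 N y yx yu v u2 = 0"
  shows "det5 N y (yx + m *s yu) (yxx + (2 * m) *s yxu + m\<^sup>2 *s yuu) v (u1 + m *s u2) =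
    det5 N y yx yxx v u1
    + (det5 N y yu yxx v u1 + 2 * det5 N y yx yxu v u1 + det5 N y yx yxx v u2) * m
    + (det5 N y yx yuu v u1 + 2 * det5 N y yu yxu v u1 + det5 N y yu yxx v u2
        + 2 * det5 N y yx yxu v u2) * m\<^sup>2
    + (det5 N y yu yuu v u1 + det5 N y yx yuu v u2 + 2 * det5 N y yu yxu v u2) * m ^ 3"
proof -
  have "det5 N y yu yuu v u2 = 0"
    using z by (simp add: yuu det5_add det5_scale det5_same det5_swap[of N y yu yx])
  then show ?thesis
    by (simp add: det5_add det5_scale algebra_simps power2_eq_square power3_eq_cube)
qed

text \<open>Meeting in a line bounds the dimension of the sum by 4, which gives the first claim. If
  the determinant with \<open>u1\<close> vanished too, no plane of the pencil would be transversal
  to the tangent plane; uniqueness would then push the whole pencil, of dimension 4, into the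
  tangent plane, of dimension 3.\<close>

lemma asymptotic_plane_det5:
  fixes y :: "complex ^ 'n"
  assumes E: "det5 N y yx yu yxx yxu \<noteq> 0"
    and vu: "{v, u1, u2} \<subseteq> vec.span {y, yx, yu, yxx, yxu}"
    and dim: "vec.dim {y, v, u1, u2} = 4"
    and meet: "meet_in_line (vec.span {y, v, u2}) (vec.span {y, yx, yu})"
    and only: "\<And>m. meet_in_line (vec.span {y, v, u1 + m *s u2}) (vec.span {y, yx, yu}) \<Longrightarrow>
      vec.span {y, v, u1 + m *s u2} = vec.span {y, v, u2}"
  shows "det5 N y yx yu v u2 = 0" and "det5 N y yx yu v u1 \<noteq> 0"
proof -
  have mem: "{y, yx, yu, yxx, yxu} \<subseteq> vec.span {y, yx, yu, yxx, yxu}" by (rule vec.span_superset)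
  have T: "vec.dim {y, yx, yu} = 3"
    using dim_eq_5_if_det5[OF E] vec_dim_insert_le[of yxx "{y, yx, yu, yxu}"]
      vec_dim_insert_le[of yxu "{y, yx, yu}"] dim_3_le[of y yx yu] by (simp add: insert_commute)
  have L2: "vec.dim {y, v, u2} = 3"
    using dim vec_dim_insert_le[of u1 "{y, v, u2}"] dim_3_le[of y v u2] by (simp add: insert_commute)
  have "vec.dim {y, yx, yu, v, u2} = 4"
    using meet unfolding meet_in_line_def[of "vec.span {y, v, u2}"] Int_commute[of "vec.span {y, v, u2}"]
      meet_in_line_def[symmetric] meet_in_line_iff_dim[OF T L2] .
  then show z: "det5 N y yx yu v u2 = 0" using dim_eq_5_if_det5[of N y yx yu v u2] by auto
  have dim': "vec.dim {y, v, u1 + m *s u2, u2} \<ge> 4" for m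
  proof -
    have "u1 + m *s u2 - m *s u2 \<in> vec.span {y, v, u1 + m *s u2, u2}"
      by (intro vec.span_diff vec.span_scale vec.span_base) auto
    then have "{y, v, u1, u2} \<subseteq> vec.span {y, v, u1 + m *s u2, u2}"
      by (auto intro: vec.span_base)
    from vec.dim_mono[OF this] show ?thesis using dim by simp
  qed
  show "det5 N y yx yu v u1 \<noteq> 0"
  proof
    assume z1: "det5 N y yx yu v u1 = 0"
    have inT: "v \<in> vec.span {y, yx, yu} \<and> u1 + m *s u2 \<in> vec.span {y, yx, yu}" for m
    proof -
      let ?w = "u1 + m *s u2"
      have L: "vec.dim {y, v, ?w} = 3"
        using dim'[of m] vec_dim_insert_le[of u2 "{y, v, ?w}"] dim_3_le[of y v ?w]
        by (simp add: insert_commute)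
      have sub: "{y, yx, yu, v, ?w} \<subseteq> vec.span {y, yx, yu, yxx, yxu}"
        using mem vu by (auto intro!: vec.span_add vec.span_scale)
      have "det5 N y yx yu v ?w = 0" using z z1 by (simp add: det5_add det5_scale)
      then have "vec.dim {y, yx, yu, v, ?w} \<noteq> 5" using det5_nonzero_iff_dim[OF E sub] by blast
      \<comment> \<open>Dimension 4 would mean meeting in a line, hence coincidence with the
        asymptotic plane. That contradicts the independence of \<open>u1 + m *s u2\<close> and
        \<open>u2\<close> modulo \<open>y\<close> and \<open>v\<close>.\<close>
      moreover have "vec.dim {y, yx, yu, v, ?w} \<noteq> 4"
      proof
        assume "vec.dim {y, yx, yu, v, ?w} = 4"
        then have "vec.span {y, v, ?w} = vec.span {y, v, u2}"
          using only[of m] unfolding meet_in_line_def[of "vec.span {y, v, ?w}"]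
            Int_commute[of "vec.span {y, v, ?w}"] meet_in_line_def[symmetric]
            meet_in_line_iff_dim[OF T L] by blast
        then have "?w \<in> vec.span {y, v, u2}" by (metis insertI1 insertI2 vec.span_base)
        then have "vec.dim {y, v, ?w, u2} = vec.dim {y, v, u2}"
          using vec.dim_insert[of ?w "{y, v, u2}"] by (simp add: insert_commute)
        with dim'[of m] L2 show False by simp
      qed
      ultimately have "vec.dim {y, yx, yu, v, ?w} \<le> 3" using vec_dim_le_5[of y yx yu v ?w] by linarith
      moreover have "vec.dim {y, yx, yu, v} \<le> vec.dim {y, yx, yu, v, ?w}"
        "vec.dim {y, yx, yu, ?w} \<le> vec.dim {y, yx, yu, v, ?w}"
        by (rule vec.dim_subset; auto)+
      ultimately have "vec.dim {y, yx, yu, v} \<le> 3" "vec.dim {y, yx, yu, ?w} \<le> 3" by simp_all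
      then show ?thesis
        using vec.dim_insert[of v "{y, yx, yu}"] vec.dim_insert[of ?w "{y, yx, yu}"] T
        by (auto simp: insert_commute split: if_splits)
    qed
    have u1: "u1 \<in> vec.span {y, yx, yu}" using inT[of 0] by simp
    \<comment> \<open>The values \<open>m = 0\<close> and \<open>m = 1\<close> place
      \<open>u1\<close> and \<open>u1 + u2\<close>, hence also \<open>u2\<close>, in the tangent
      plane.\<close>
    have "u1 + 1 *s u2 - u1 \<in> vec.span {y, yx, yu}" using inT[of 1] u1 by (intro vec.span_diff) auto
    then have "{y, v, u1, u2} \<subseteq> vec.span {y, yx, yu}" using u1 inT[of 0] by (auto intro: vec.span_base)
    from vec.dim_mono[OF this] show False using dim T by simp
  qed
qed

section \<open>Curves and pencils on the surface\<close>

text \<open>The columns of \<open>M\<close> define new generators of the pencil, in which the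
  projective relation with the tangents becomes the identity.\<close>

lemma vec2_scale_add:
  fixes M :: "complex ^ 2 ^ 2"
  shows "(M *v d) $ 1 *s w\<^sub>1 + (M *v d) $ 2 *s w\<^sub>2 =
    d $ 1 *s (M $ 1 $ 1 *s w\<^sub>1 + M $ 2 $ 1 *s w\<^sub>2) + d $ 2 *s (M $ 1 $ 2 *s w\<^sub>1 + M $ 2 $ 2 *s w\<^sub>2)"
  by (simp add: matrix_vector_mult_def sum_2 vec_eq_iff algebra_simps)

text \<open>Two distinct planes with a common axis span dimension 4, and an invertible change of
  generators preserves this span.\<close>

lemma dim_pencil_basis_change:
  fixes M :: "complex ^ 2 ^ 2"
  assumes d: "vec.dim {y, v, w\<^sub>1} = 3" "vec.dim {y, v, w\<^sub>2} = 3"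
    and ne: "vec.span {y, v, w\<^sub>1} \<noteq> vec.span {y, v, w\<^sub>2}" and M: "invertible M"
  shows "vec.dim {y, v, M $ 1 $ 1 *s w\<^sub>1 + M $ 2 $ 1 *s w\<^sub>2, M $ 1 $ 2 *s w\<^sub>1 + M $ 2 $ 2 *s w\<^sub>2} = 4"
proof -
  define u1 where "u1 = M $ 1 $ 1 *s w\<^sub>1 + M $ 2 $ 1 *s w\<^sub>2"
  define u2 where "u2 = M $ 1 $ 2 *s w\<^sub>1 + M $ 2 $ 2 *s w\<^sub>2"
  define D where "D = M $ 1 $ 1 * M $ 2 $ 2 - M $ 1 $ 2 * M $ 2 $ 1"
  have "D \<noteq> 0" using M unfolding D_def invertible_det_nz det_2 by simp
  have "w\<^sub>1 \<notin> vec.span {y, v, w\<^sub>2}"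
  proof
    assume "w\<^sub>1 \<in> vec.span {y, v, w\<^sub>2}"
    then have "{y, v, w\<^sub>1} \<subseteq> vec.span {y, v, w\<^sub>2}" by (auto intro: vec.span_base)
    then have "vec.span {y, v, w\<^sub>1} = vec.span (vec.span {y, v, w\<^sub>2})"
      using d by (intro vec.dim_eq_span) auto
    then show False using ne by (simp add: vec.span_span)
  qed
  then have "4 = vec.dim {y, v, w\<^sub>1, w\<^sub>2}"
    using vec.dim_insert[of w\<^sub>1 "{y, v, w\<^sub>2}"] d by (simp add: insert_commute)
  also have "{y, v, w\<^sub>1, w\<^sub>2} \<subseteq> vec.span {y, v, u1, u2}"
  proof -
    \<comment> \<open>Cramer's rule for the 2 by 2 matrix \<open>M\<close> with determinant
      \<open>D\<close>.\<close>
    have "w\<^sub>1 = (M $ 2 $ 2 / D) *s u1 - (M $ 2 $ 1 / D) *s u2"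
      using \<open>D \<noteq> 0\<close> by (simp add: u1_def u2_def vec_eq_iff field_simps) (simp add: D_def algebra_simps)
    moreover have "w\<^sub>2 = (M $ 1 $ 1 / D) *s u2 - (M $ 1 $ 2 / D) *s u1"
      using \<open>D \<noteq> 0\<close> by (simp add: u1_def u2_def vec_eq_iff field_simps) (simp add: D_def algebra_simps)
    moreover have "(M $ 2 $ 2 / D) *s u1 - (M $ 2 $ 1 / D) *s u2 \<in> vec.span {y, v, u1, u2}"
       "(M $ 1 $ 1 / D) *s u2 - (M $ 1 $ 2 / D) *s u1 \<in> vec.span {y, v, u1, u2}"
      by (intro vec.span_diff vec.span_scale vec.span_base; simp)+
    ultimately show ?thesis by (auto intro: vec.span_base)
  qed
  then have "vec.dim {y, v, w\<^sub>1, w\<^sub>2} \<le> vec.dim {y, v, u1, u2}" by (rule vec.dim_mono)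
  finally have "4 \<le> vec.dim {y, v, u1, u2}" .
  moreover have "vec.dim {y, v, u1, u2} \<le> 4"
    using vec_dim_insert_le[of u2 "{y, v, u1}"] dim_3_le[of y v u1] by (simp add: insert_commute)
  ultimately show ?thesis unfolding u1_def u2_def by simp
qed

lemma S20_eq_span:
  assumes "partial_u (partial_u y) p = a *s partial_x y p + b *s partial_u y p + c *s y p"
  shows "S20 y p = vec.span {y p, partial_x y p, partial_u y p, partial_x (partial_x y) p, partial_u (partial_x y) p}"
    (is "_ = vec.span ?B")
proof -
  have "partial_u (partial_u y) p \<in> vec.span ?B"
    unfolding assms by (intro vec.span_add vec.span_scale vec.span_base) auto
  moreover have "S20 y p = vec.span (insert (partial_u (partial_u y) p) ?B)"
    unfolding S20_def by (simp add: insert_commute)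
  ultimately show ?thesis by (simp add: vec.span_redundant)
qed

text \<open>The osculating plane as a function of the 2-jet of a curve: \<open>m\<close> stands for
  u' and \<open>r\<close> for u''. This turns the condition on curves into a pointwise one with free
  parameters.\<close>

definition osculating_span ::
  "(complex \<times> complex \<Rightarrow> complex ^ 'n) \<Rightarrow> complex \<times> complex \<Rightarrow> complex \<Rightarrow> complex \<Rightarrow> (complex ^ 'n) set" where
  "osculating_span y p m r = vec.span {y p, partial_x y p + m *s partial_u y p,
     partial_x (partial_x y) p + (2 * m) *s partial_u (partial_x y) p
       + m\<^sup>2 *s partial_u (partial_u y) p + r *s partial_u y p}"

lemma osculating_plane_eq:
  assumes U: "open U" and y: "vec_analytic2_on y U" and f: "(W, f) \<in> curves U" and x: "x \<in> W"
  shows "osculating_plane y f x = osculating_span y (x, f x) (deriv f x) (deriv (deriv f) x)"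
proof -
  have f': "open W" "f holomorphic_on W" "\<And>x. x \<in> W \<Longrightarrow> (x, f x) \<in> U"
    using f by (auto simp: curves_def)
  show ?thesis
    unfolding osculating_plane_def osculating_span_def Let_def
    by (simp add: vec_deriv_vec_deriv_curve[OF U y f' x]
        vec_deriv_curve[OF y f'(3)[OF x] holomorphic_derivI[OF f'(2,1) x]])
qed

text \<open>It suffices to compare the two conditions on all 2-jets; every curve of the surface then
  satisfies both or neither.\<close>

lemma pencil_system_eq_cubic_ode_system:
  assumes U: "open U" and y: "vec_analytic2_on y U"
    and eq: "\<And>p m r. p \<in> U \<Longrightarrow> meet_in_line (osculating_span y p m r) (pl p (vector [1, m])) \<longleftrightarrow>
      r = A p + B p * m + C p * m\<^sup>2 + D p * m ^ 3"
  shows "pencil_system U y pl = cubic_ode_system U A B C D"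
proof -
  have "meet_in_line (osculating_plane y f x) (pl (x, f x) (vector [1, deriv f x])) \<longleftrightarrow>
    deriv (deriv f) x = A (x, f x) + B (x, f x) * deriv f x
              + C (x, f x) * (deriv f x)\<^sup>2 + D (x, f x) * (deriv f x) ^ 3"
    if "(W, f) \<in> curves U" "x \<in> W" for W f x
    unfolding osculating_plane_eq[OF U y that] using that by (intro eq) (auto simp: curves_def)
  then show ?thesis unfolding pencil_system_def cubic_ode_system_def by auto
qed

section \<open>Direct statement: the cubic equation near a point\<close>

lemma local_cubic:
  fixes y :: "complex \<times> complex \<Rightarrow> complex ^ 'n"
  assumes S: "surface_with_asymptotics U y" and rel: "related_pencil_field U y pl"
    and asy: "asymptotic_plane_condition U y pl" and q: "q \<in> U"
  obtains V A B C D where "open V" "q \<in> V" "V \<subseteq> U"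
    "analytic2_on A V" "analytic2_on B V" "analytic2_on C V" "analytic2_on D V"
    "\<And>p m r. p \<in> V \<Longrightarrow> meet_in_line (osculating_span y p m r) (pl p (vector [1, m])) \<longleftrightarrow>
      r = A p + B p * m + C p * m\<^sup>2 + D p * m ^ 3"
proof -
  obtain a b c where U: "open U" and y: "vec_analytic2_on y U"
    and yuu: "\<And>p. p \<in> U \<Longrightarrow> partial_u (partial_u y) p
                  = a p *s partial_x y p + b p *s partial_u y p + c p *s y p"
    and dim: "\<And>p. p \<in> U \<Longrightarrow> vec.dim (S20 y p) = 5"
    using S unfolding surface_with_asymptotics_def by metis
  let ?yx = "partial_x y" and ?yu = "partial_u y" and ?yxx = "partial_x (partial_x y)"
    and ?yxu = "partial_u (partial_x y)" and ?yuu = "partial_u (partial_u y)"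
  obtain V v w1 w2 and M :: "complex \<times> complex \<Rightarrow> complex ^ 2 ^ 2" where
      V: "open V" "q \<in> V" "V \<subseteq> U" and
      an: "vec_analytic2_on v V" "vec_analytic2_on w1 V" "vec_analytic2_on w2 V"
        "\<forall>i j. analytic2_on (\<lambda>p. M p $ i $ j) V" and
      pen: "\<forall>p\<in>V. {v p, w1 p, w2 p} \<subseteq> S20 y p \<and>
           vec.dim {y p, v p} = 2 \<and>
           vec.dim {y p, v p, w1 p} = 3 \<and> vec.dim {y p, v p, w2 p} = 3 \<and>
           vec.span {y p, v p, w1 p} \<noteq> vec.span {y p, v p, w2 p} \<and>
           invertible (M p) \<and>
           (\<forall>d. d \<noteq> 0 \<longrightarrow> pl p d = pencil_plane (y p) (v p) (w1 p) (w2 p) (M p *v d))"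
    using bspec[OF rel[unfolded related_pencil_field_def] q] by (elim exE conjE) (rule that)
  define u1 where "u1 = (\<lambda>p. M p $ 1 $ 1 *s w1 p + M p $ 2 $ 1 *s w2 p)"
  define u2 where "u2 = (\<lambda>p. M p $ 1 $ 2 *s w1 p + M p $ 2 $ 2 *s w2 p)"
  have an': "vec_analytic2_on u1 V" "vec_analytic2_on u2 V"
    unfolding u1_def u2_def by (intro vec_analytic2_on_add vec_analytic2_on_scale an(1-3) an(4)[rule_format])+
  have yan: "vec_analytic2_on y V" "vec_analytic2_on ?yx V" "vec_analytic2_on ?yu V"
    "vec_analytic2_on ?yxx V" "vec_analytic2_on ?yxu V" "vec_analytic2_on ?yuu V"
    by (intro vec_analytic2_on_subset[OF _ V(3)] vec_analytic2_on_partial U y)+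
  have S20: "S20 y p = vec.span {y p, ?yx p, ?yu p, ?yxx p, ?yxu p}" if "p \<in> V" for p
    using S20_eq_span yuu V that by blast
  have "vec.dim {y q, ?yx q, ?yu q, ?yxx q, ?yxu q} = 5"
    using dim[OF q] S20[OF V(2)] by (metis vec.dim_span)
  then obtain N where N: "det5 N (y q) (?yx q) (?yu q) (?yxx q) (?yxu q) \<noteq> 0"
    by (rule ex_det5_nonzero)
  let ?\<Delta> = "\<lambda>a b c d e p. det5 N (a p) (b p) (c p) (d p) (e p)"
  have det: "analytic2_on (?\<Delta> a b c d e) V"
    if "vec_analytic2_on a V" "vec_analytic2_on b V" "vec_analytic2_on c V"
      "vec_analytic2_on d V" "vec_analytic2_on e V" for a b c d e
  proof -
    have "analytic2_on (\<lambda>p. list5 (a p) (b p) (c p) (d p) (e p) i $ k) V" for i k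
      using exhaust_5[of i] that by (elim disjE) (simp_all add: vec_analytic2_on_def)
    then show ?thesis unfolding det5_def
      by (intro analytic2_on_det, unfold vec_lambda_beta matrix_vector_mult_def)
         (intro analytic2_on_sum analytic2_on_mult analytic2_on_const)
  qed
  \<comment> \<open>\<open>N\<close> is chosen at \<open>q\<close> only and then kept constant. The
    frame determinant is continuous, so \<open>N\<close> still detects independence in S(2,0) on a
    neighbourhood of \<open>q\<close>.\<close>
  define V' where "V' = {p \<in> V. ?\<Delta> y ?yx ?yu ?yxx ?yxu p \<noteq> 0}"
  have "open V'"
  proof -
    have "continuous_on V (?\<Delta> y ?yx ?yu ?yxx ?yxu)"
      by (intro analytic2_on_imp_continuous_on det yan)
    then have "open (V \<inter> ?\<Delta> y ?yx ?yu ?yxx ?yxu -` (- {0}))"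
      using V(1) by (intro continuous_open_preimage) auto
    also have "V \<inter> ?\<Delta> y ?yx ?yu ?yxx ?yxu -` (- {0}) = V'" by (auto simp: V'_def)
    finally show ?thesis .
  qed
  have V': "V' \<subseteq> V" "q \<in> V'" using N V(2) by (auto simp: V'_def)
  have plane: "pl p (vector [1, m]) = vec.span {y p, v p, u1 p + m *s u2 p}"
    "pl p (vector [0, 1]) = vec.span {y p, v p, u2 p}" if "p \<in> V" for p m
  proof -
    have nz: "vector [1, m] \<noteq> (0 :: complex ^ 2)" "vector [0, 1] \<noteq> (0 :: complex ^ 2)"
      by (auto simp: vec_eq_iff forall_2)
    show "pl p (vector [1, m]) = vec.span {y p, v p, u1 p + m *s u2 p}"
      "pl p (vector [0, 1]) = vec.span {y p, v p, u2 p}"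
      using bspec[OF pen that] nz
      by (simp_all add: pencil_plane_def vec2_scale_add u1_def u2_def)
  qed
  have mem: "{v p, u1 p, u2 p} \<subseteq> vec.span {y p, ?yx p, ?yu p, ?yxx p, ?yxu p}" if "p \<in> V" for p
    using bspec[OF pen that] unfolding S20[OF that] u1_def u2_def
    by (auto intro!: vec.span_add vec.span_scale)
  have dims: "vec.dim {y p, v p, u1 p, u2 p} = 4" if "p \<in> V" for p
    unfolding u1_def u2_def using bspec[OF pen that] by (intro dim_pencil_basis_change) auto
  have z: "?\<Delta> y ?yx ?yu v u2 p = 0" and nz: "?\<Delta> y ?yx ?yu v u1 p \<noteq> 0" if p: "p \<in> V'" for p
  proof -
    have pV: "p \<in> V" and E: "?\<Delta> y ?yx ?yu ?yxx ?yxu p \<noteq> 0" using p by (auto simp: V'_def)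
    have T: "meet_in_line (vec.span {y p, v p, u2 p}) (vec.span {y p, ?yx p, ?yu p})"
      using asy V(3) pV unfolding asymptotic_plane_condition_def tangent_plane_def plane(2)[OF pV, symmetric]
      by blast
    have only: "vec.span {y p, v p, u1 p + m *s u2 p} = vec.span {y p, v p, u2 p}"
      if "meet_in_line (vec.span {y p, v p, u1 p + m *s u2 p}) (vec.span {y p, ?yx p, ?yu p})" for m
    proof -
      have "vector [1, m] \<noteq> (0 :: complex ^ 2)" by (auto simp: vec_eq_iff forall_2)
      then have "pl p (vector [1, m]) = pl p (vector [0, 1])"
        using asy V(3) pV that
        unfolding asymptotic_plane_condition_def tangent_plane_def plane(1)[OF pV, symmetric] by blast
      then show ?thesis by (simp add: plane[OF pV])
    qed
    show "?\<Delta> y ?yx ?yu v u2 p = 0" "?\<Delta> y ?yx ?yu v u1 p \<noteq> 0"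
      using asymptotic_plane_det5[OF E mem[OF pV] dims[OF pV] T only] by blast+
  qed
  \<comment> \<open>\<open>\<kappa>\<close> will be the coefficient of u''. The functions
    \<open>P0\<close> to \<open>P3\<close> are the coefficients given by
    \<open>det5_osculating_cubic\<close>, so the equation arises on division by
    \<open>- \<kappa>\<close>.\<close>
  define \<kappa> where "\<kappa> = ?\<Delta> y ?yx ?yu v u1"
  define P0 where "P0 = ?\<Delta> y ?yx ?yxx v u1"
  define P1 where "P1 = (\<lambda>p. ?\<Delta> y ?yu ?yxx v u1 p + 2 * ?\<Delta> y ?yx ?yxu v u1 p + ?\<Delta> y ?yx ?yxx v u2 p)"
  define P2 where "P2 = (\<lambda>p. ?\<Delta> y ?yx ?yuu v u1 p + 2 * ?\<Delta> y ?yu ?yxu v u1 p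
      + ?\<Delta> y ?yu ?yxx v u2 p + 2 * ?\<Delta> y ?yx ?yxu v u2 p)"
  define P3 where "P3 = (\<lambda>p. ?\<Delta> y ?yu ?yuu v u1 p + ?\<Delta> y ?yx ?yuu v u2 p + 2 * ?\<Delta> y ?yu ?yxu v u2 p)"
  have P: "analytic2_on P0 V" "analytic2_on P1 V" "analytic2_on P2 V" "analytic2_on P3 V"
    "analytic2_on \<kappa> V"
    unfolding P0_def P1_def P2_def P3_def \<kappa>_def
    by (intro analytic2_on_add analytic2_on_mult analytic2_on_const det yan an an')+
  have \<kappa>: "\<kappa> p \<noteq> 0" if "p \<in> V'" for p using nz[OF that] by (simp add: \<kappa>_def)
  have an3: "analytic2_on (\<lambda>p. - Q p / \<kappa> p) V'" if "analytic2_on Q V" for Q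
    by (intro analytic2_on_divide analytic2_on_uminus analytic2_on_subset[OF that V'(1)]
        analytic2_on_subset[OF P(5) V'(1)] \<kappa>)
  show thesis
  proof (rule that[of V' "\<lambda>p. - P0 p / \<kappa> p" "\<lambda>p. - P1 p / \<kappa> p" "\<lambda>p. - P2 p / \<kappa> p" "\<lambda>p. - P3 p / \<kappa> p"])
    show "V' \<subseteq> U" using V' V by blast
    fix p m r assume p: "p \<in> V'"
    then have pV: "p \<in> V" "p \<in> U" and E: "?\<Delta> y ?yx ?yu ?yxx ?yxu p \<noteq> 0" using V by (auto simp: V'_def)
    let ?w = "u1 p + m *s u2 p"
    have root: "X + r * \<kappa> p = 0 \<longleftrightarrow> r = - X / \<kappa> p" for X
      unfolding nonzero_eq_divide_eq[OF \<kappa>[OF p]] eq_neg_iff_add_eq_0 by (simp add: add.commute)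
    \<comment> \<open>The \<open>u2\<close> part contributes nothing, by the asymptotic condition;
      hence the coefficient of u'' does not depend on the direction \<open>m\<close>.\<close>
    have \<kappa>w: "det5 N (y p) (?yx p) (?yu p) (v p) ?w = \<kappa> p"
      using z[OF p] by (simp add: \<kappa>_def det5_add det5_scale)
    have "meet_in_line (osculating_span y p m r) (pl p (vector [1, m])) \<longleftrightarrow>
      det5 N (y p) (?yx p + m *s ?yu p) (?yxx p + (2 * m) *s ?yxu p + m\<^sup>2 *s ?yuu p) (v p) ?w
        + r * \<kappa> p = 0"
      unfolding plane(1)[OF pV(1)] osculating_span_def \<kappa>w[symmetric]
    proof (rule meet_osculating_iff_det5[OF E yuu[OF pV(2)] _ _ refl])
      show "{v p, ?w} \<subseteq> vec.span {y p, ?yx p, ?yu p, ?yxx p, ?yxu p}"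
        using mem[OF pV(1)] by (auto intro!: vec.span_add vec.span_scale)
    qed (use \<kappa>[OF p] \<kappa>w in simp)
    also have "\<dots> \<longleftrightarrow> P0 p + P1 p * m + P2 p * m\<^sup>2 + P3 p * m ^ 3 + r * \<kappa> p = 0"
      unfolding det5_osculating_cubic[OF yuu[OF pV(2)] z[OF p]]
      by (simp add: P0_def P1_def P2_def P3_def)
    also have "\<dots> \<longleftrightarrow> r = - (P0 p + P1 p * m + P2 p * m\<^sup>2 + P3 p * m ^ 3) / \<kappa> p"
      by (rule root)
    also have "- (P0 p + P1 p * m + P2 p * m\<^sup>2 + P3 p * m ^ 3) / \<kappa> p =
        - P0 p / \<kappa> p + - P1 p / \<kappa> p * m + - P2 p / \<kappa> p * m\<^sup>2 + - P3 p / \<kappa> p * m ^ 3"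
      by (simp add: add_divide_distrib diff_divide_distrib)
    finally show "meet_in_line (osculating_span y p m r) (pl p (vector [1, m])) \<longleftrightarrow>
      r = - P0 p / \<kappa> p + - P1 p / \<kappa> p * m + - P2 p / \<kappa> p * m\<^sup>2 + - P3 p / \<kappa> p * m ^ 3" .
  qed (use \<open>open V'\<close> V' an3 P in blast)+
qed

section \<open>Gluing the local equations\<close>

lemma cubic_coeffs_unique:
  fixes a b c d :: complex
  assumes "\<And>m. a + b * m + c * m\<^sup>2 + d * m ^ 3 = a' + b' * m + c' * m\<^sup>2 + d' * m ^ 3"
  shows "a = a' \<and> b = b' \<and> c = c' \<and> d = d'"
proof -
  have "poly [:a, b, c, d:] m = poly [:a', b', c', d':] m" for m
    using assms[of m] by (simp add: algebra_simps power2_eq_square power3_eq_cube)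
  then have "[:a, b, c, d:] = [:a', b', c', d':]"
    by (simp add: poly_eq_poly_eq_iff[symmetric] fun_eq_iff)
  then show ?thesis by simp
qed

lemma analytic2_on_locally:
  assumes "\<And>p. p \<in> U \<Longrightarrow> \<exists>V g. open V \<and> p \<in> V \<and> analytic2_on g V \<and> (\<forall>z\<in>V. g z = f z)"
  shows "analytic2_on f U"
  unfolding analytic2_on_def
proof
  fix p assume "p \<in> U"
  then obtain V g where V: "open V" "p \<in> V" "analytic2_on g V" "\<forall>z\<in>V. g z = f z" using assms by blast
  then obtain fx fu where "(g has_derivative (\<lambda>(h, k). fx * h + fu * k)) (at p)"
    unfolding analytic2_on_def by blast
  then have "(f has_derivative (\<lambda>(h, k). fx * h + fu * k)) (at p)"
    by (rule has_derivative_transform_within_open[OF _ V(1,2)]) (use V(4) in auto)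
  then show "\<exists>fx fu. (f has_derivative (\<lambda>(h, k). fx * h + fu * k)) (at p)" by blast
qed

text \<open>Analytic representatives of the pencil exist only locally. The pencil at a point
  determines the four coefficients there, so the local coefficients agree on overlaps and form
  functions on all of \<open>U\<close>.\<close>

lemma pencil_system_is_cubic:
  fixes y :: "complex \<times> complex \<Rightarrow> complex ^ 'n"
  assumes S: "surface_with_asymptotics U y" and rel: "related_pencil_field U y pl"
    and asy: "asymptotic_plane_condition U y pl"
  obtains A B C D where "analytic2_on A U" "analytic2_on B U" "analytic2_on C U" "analytic2_on D U"
    "pencil_system U y pl = cubic_ode_system U A B C D"
proof -
  have U: "open U" and y: "vec_analytic2_on y U"
    using S unfolding surface_with_asymptotics_def by auto
  define cub where "cub = (\<lambda>p k. \<forall>m r. meet_in_line (osculating_span y p m r) (pl p (vector [1, m])) \<longleftrightarrow>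
      r = (case k of (a, b, c, d) \<Rightarrow> a + b * m + c * m\<^sup>2 + d * m ^ 3))"
  have loc: "\<exists>V A B C D. open V \<and> q \<in> V \<and> V \<subseteq> U \<and> analytic2_on A V \<and> analytic2_on B V \<and>
      analytic2_on C V \<and> analytic2_on D V \<and> (\<forall>p\<in>V. cub p (A p, B p, C p, D p))" if "q \<in> U" for q
  proof (rule local_cubic[OF S rel asy that], goal_cases)
    case (1 V A B C D)
    then show ?case unfolding cub_def prod.case
      by (intro exI[of _ V] exI[of _ A] exI[of _ B] exI[of _ C] exI[of _ D] conjI ballI allI) assumption+
  qed
  have uniq: "k = k'" if "cub p k" "cub p k'" for p k k'
  proof -
    obtain a b c d a' b' c' d' where k: "k = (a, b, c, d)" "k' = (a', b', c', d')"
      by (meson prod_cases4)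
    have "a + b * m + c * m\<^sup>2 + d * m ^ 3 = a' + b' * m + c' * m\<^sup>2 + d' * m ^ 3" for m
      using that unfolding cub_def k by auto
    from cubic_coeffs_unique[OF this] show ?thesis by (simp add: k)
  qed
  \<comment> \<open>The choice is harmless: by \<open>uniq\<close> it coincides near each point with
    the local analytic coefficients.\<close>
  define k where "k = (\<lambda>p. SOME k. cub p k)"
  have k: "cub p (k p)" if "p \<in> U" for p
    unfolding k_def using loc[OF that] by (blast intro: someI)
  let ?A = "\<lambda>p. fst (k p)" and ?B = "\<lambda>p. fst (snd (k p))"
    and ?C = "\<lambda>p. fst (snd (snd (k p)))" and ?D = "\<lambda>p. snd (snd (snd (k p)))"
  have loc': "\<exists>V A B C D. open V \<and> q \<in> V \<and> analytic2_on A V \<and> analytic2_on B V \<and>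
      analytic2_on C V \<and> analytic2_on D V \<and>
      (\<forall>p\<in>V. A p = ?A p \<and> B p = ?B p \<and> C p = ?C p \<and> D p = ?D p)" if q: "q \<in> U" for q
  proof -
    obtain V A B C D where V: "open V" "q \<in> V" "V \<subseteq> U" "analytic2_on A V" "analytic2_on B V"
      "analytic2_on C V" "analytic2_on D V" "\<forall>p\<in>V. cub p (A p, B p, C p, D p)"
      using loc[OF q] by blast
    have "k p = (A p, B p, C p, D p)" if "p \<in> V" for p
      using uniq k V that by blast
    then show ?thesis using V by (intro exI[of _ V] exI[of _ A] exI[of _ B] exI[of _ C] exI[of _ D]) auto
  qed
  show thesis
  proof (rule that)
    show "analytic2_on ?A U" "analytic2_on ?B U" "analytic2_on ?C U" "analytic2_on ?D U"
      by (rule analytic2_on_locally, drule loc', elim exE conjE, intro exI conjI, assumption+, blast)+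
    show "pencil_system U y pl = cubic_ode_system U ?A ?B ?C ?D"
      using k by (intro pencil_system_eq_cubic_ode_system[OF U y]) (auto simp: cub_def case_prod_unfold)
  qed
qed

section \<open>Converse: a pencil for a given cubic equation\<close>

lemma cubic_is_pencil_system:
  fixes y :: "complex \<times> complex \<Rightarrow> complex ^ 'n"
  assumes S: "surface_with_asymptotics U y"
    and an: "analytic2_on A U" "analytic2_on B U" "analytic2_on C U" "analytic2_on D U"
  obtains pl where "related_pencil_field U y pl" "asymptotic_plane_condition U y pl"
    "pencil_system U y pl = cubic_ode_system U A B C D"
proof -
  obtain a b c where U: "open U" and y: "vec_analytic2_on y U"
    and abc: "analytic2_on a U" "analytic2_on b U" "analytic2_on c U"
    and yuu: "\<And>p. p \<in> U \<Longrightarrow> partial_u (partial_u y) p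
                  = a p *s partial_x y p + b p *s partial_u y p + c p *s y p"
    and dim: "\<And>p. p \<in> U \<Longrightarrow> vec.dim (S20 y p) = 5"
    using S unfolding surface_with_asymptotics_def by metis
  let ?yx = "partial_x y" and ?yu = "partial_u y" and ?yxx = "partial_x (partial_x y)"
    and ?yxu = "partial_u (partial_x y)" and ?yuu = "partial_u (partial_u y)"
  have yan: "vec_analytic2_on ?yx U" "vec_analytic2_on ?yu U" "vec_analytic2_on ?yxx U"
    "vec_analytic2_on ?yxu U"
    by (intro vec_analytic2_on_partial U y)+
  define v where "v = (\<lambda>p. ?yxx p + (- B p) *s ?yx p + A p *s ?yu p)"
  \<comment> \<open>\<open>\<gamma>\<close> and \<open>\<eta>\<close> solve
    \<open>C = 2 - b - 2 * \<gamma>\<close> and \<open>D = a - 2 * \<eta>\<close>, the equations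
    obtained from the coefficients of \<open>m\<^sup>2\<close> and \<open>m ^ 3\<close> on
    \<open>partial_u y\<close> in the decomposition \<open>h\<close> below.\<close>
  define \<gamma> where "\<gamma> = (\<lambda>p. (2 - b p - C p) * (1/2))"
  define \<eta> where "\<eta> = (\<lambda>p. (a p - D p) * (1/2))"
  define w1 where "w1 = (\<lambda>p. ?yxu p + \<gamma> p *s ?yx p)"
  \<comment> \<open>\<open>w2\<close> is tangent to the surface, so the plane for dx = 0 meets the
    tangent plane along the line joining \<open>y\<close> and \<open>w2\<close>.\<close>
  define w2 where "w2 = (\<lambda>p. \<eta> p *s ?yx p + ?yu p)"
  define pl where "pl = (\<lambda>p (d :: complex ^ 2). vec.span {y p, v p, d $ 1 *s w1 p + d $ 2 *s w2 p})"
  have van: "vec_analytic2_on v U" "vec_analytic2_on w1 U" "vec_analytic2_on w2 U"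
    unfolding v_def w1_def w2_def \<gamma>_def \<eta>_def
    by (intro vec_analytic2_on_add vec_analytic2_on_scale analytic2_on_mult analytic2_on_diff
        analytic2_on_uminus analytic2_on_const yan an abc)+
  have S20: "S20 y p = vec.span {y p, ?yx p, ?yu p, ?yxx p, ?yxu p}" if "p \<in> U" for p
    using S20_eq_span yuu that by blast
  have mem: "{v p, w1 p, w2 p} \<subseteq> vec.span {y p, ?yx p, ?yu p, ?yxx p, ?yxu p}" for p
  proof -
    have "{?yx p, ?yu p, ?yxx p, ?yxu p} \<subseteq> vec.span {y p, ?yx p, ?yu p, ?yxx p, ?yxu p}"
      by (auto intro: vec.span_base)
    then show ?thesis unfolding v_def w1_def w2_def
      by (auto intro!: vec.span_add vec.span_diff vec.span_scale)
  qed
  have exN: "\<exists>N. det5 N (y p) (?yx p) (?yu p) (?yxx p) (?yxu p) \<noteq> 0" if "p \<in> U" for p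
    using ex_det5_nonzero dim[OF that] S20[OF that] by (metis vec.dim_span)
  \<comment> \<open>The determinant against the tangent plane is dx times a nonzero factor: every
    plane with dx nonzero is transversal.\<close>
  have frame: "det5 N (y p) (?yx p) (?yu p) (v p) (d1 *s w1 p + d2 *s w2 p) =
      d1 * det5 N (y p) (?yx p) (?yu p) (?yxx p) (?yxu p)" for N p d1 d2
    by (simp add: v_def w1_def w2_def det5_add det5_diff det5_scale det5_same)
  \<comment> \<open>Independence of these five vectors gives all the dimension counts for the
    pencil, by leaving out vectors one at a time.\<close>
  have frame': "det5 N (y p) (?yx p) (w2 p) (v p) (w1 p) =
      det5 N (y p) (?yx p) (?yu p) (?yxx p) (?yxu p)" for N p
    by (simp add: v_def w1_def w2_def det5_add det5_diff det5_scale det5_same)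
  have dims: "vec.dim {y p, v p, w1 p, w2 p} = 4" "vec.dim {y p, v p, w1 p} = 3"
    "vec.dim {y p, v p, w2 p} = 3" "vec.dim {y p, v p} = 2" if p: "p \<in> U" for p
  proof -
    obtain N where "det5 N (y p) (?yx p) (?yu p) (?yxx p) (?yxu p) \<noteq> 0" using exN[OF p] by blast
    then have 5: "vec.dim {y p, ?yx p, w2 p, v p, w1 p} = 5"
      by (intro dim_eq_5_if_det5[of N]) (simp add: frame')
    show "vec.dim {y p, v p, w1 p, w2 p} = 4" "vec.dim {y p, v p, w1 p} = 3"
      "vec.dim {y p, v p, w2 p} = 3" "vec.dim {y p, v p} = 2"
      using 5 dim_3_le[of "y p" "v p" "w1 p"] dim_3_le[of "y p" "v p" "w2 p"]
        vec_dim_insert_le[of "?yx p" "{y p, w2 p, v p, w1 p}"]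
        vec_dim_insert_le[of "w1 p" "{y p, w2 p, v p}"] vec_dim_insert_le[of "w2 p" "{y p, v p, w1 p}"]
        vec_dim_insert_le[of "w1 p" "{y p, v p}"]
        vec_dim_insert_le[of "y p" "{v p}"] vec_dim_insert_le[of "v p" "{}"]
      by (simp_all add: insert_commute del: vec.dim_singleton)
  qed
  have T: "vec.dim {y p, ?yx p, ?yu p, v p} = 4" "vec.dim {y p, ?yx p, ?yu p} = 3" if p: "p \<in> U" for p
  proof -
    obtain N where "det5 N (y p) (?yx p) (?yu p) (?yxx p) (?yxu p) \<noteq> 0" using exN[OF p] by blast
    then have 5: "vec.dim {y p, ?yx p, ?yu p, v p, 1 *s w1 p + 0 *s w2 p} = 5"
      by (intro dim_eq_5_if_det5[of N]) (simp only: frame mult_1_left not_False_eq_True)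
    show "vec.dim {y p, ?yx p, ?yu p, v p} = 4" "vec.dim {y p, ?yx p, ?yu p} = 3"
      using 5 dim_3_le[of "y p" "?yx p" "?yu p"] vec_dim_insert_le[of "w1 p" "{y p, ?yx p, ?yu p, v p}"]
        vec_dim_insert_le[of "v p" "{y p, ?yx p, ?yu p}"]
      by (simp_all add: insert_commute)
  qed
  have rel: "related_pencil_field U y pl"
    unfolding related_pencil_field_def
  proof
    fix q assume "q \<in> U"
    have "vec.span {y p, v p, w1 p} \<noteq> vec.span {y p, v p, w2 p}" if "p \<in> U" for p
    proof
      assume "vec.span {y p, v p, w1 p} = vec.span {y p, v p, w2 p}"
      then have "w1 p \<in> vec.span {y p, v p, w2 p}" by (metis insertI1 insertI2 vec.span_base)
      then show False
        using vec.dim_insert[of "w1 p" "{y p, v p, w2 p}"] dims[OF that] by (simp add: insert_commute)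
    qed
    moreover have "pl p d = pencil_plane (y p) (v p) (w1 p) (w2 p) (mat 1 *v d)" for p d
      by (simp add: pl_def pencil_plane_def)
    ultimately show "\<exists>V v w\<^sub>1 w\<^sub>2 (M :: complex \<times> complex \<Rightarrow> complex ^ 2 ^ 2).
        open V \<and> q \<in> V \<and> V \<subseteq> U \<and>
        vec_analytic2_on v V \<and> vec_analytic2_on w\<^sub>1 V \<and> vec_analytic2_on w\<^sub>2 V \<and>
        (\<forall>i j. analytic2_on (\<lambda>p. M p $ i $ j) V) \<and>
        (\<forall>p\<in>V. {v p, w\<^sub>1 p, w\<^sub>2 p} \<subseteq> S20 y p \<and> vec.dim {y p, v p} = 2 \<and>
           vec.dim {y p, v p, w\<^sub>1 p} = 3 \<and> vec.dim {y p, v p, w\<^sub>2 p} = 3 \<and>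
           vec.span {y p, v p, w\<^sub>1 p} \<noteq> vec.span {y p, v p, w\<^sub>2 p} \<and>
           invertible (M p) \<and>
           (\<forall>d. d \<noteq> 0 \<longrightarrow> pl p d = pencil_plane (y p) (v p) (w\<^sub>1 p) (w\<^sub>2 p) (M p *v d)))"
      using U \<open>q \<in> U\<close> van dims mem
      by (intro exI[of _ U] exI[of _ v] exI[of _ w1] exI[of _ w2] exI[of _ "\<lambda>_. mat 1"])
         (simp add: S20 invertible_det_nz analytic2_on_const)
  qed
  have asy: "asymptotic_plane_condition U y pl"
    unfolding asymptotic_plane_condition_def tangent_plane_def
  proof (intro ballI conjI allI impI)
    fix p assume p: "p \<in> U"
    have pl01: "pl p (vector [0, 1]) = vec.span {y p, v p, w2 p}" by (simp add: pl_def)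
    have "w2 p \<in> vec.span {y p, ?yx p, ?yu p, v p}"
      unfolding w2_def by (intro vec.span_add vec.span_scale vec.span_base) auto
    then have "vec.dim {y p, v p, w2 p, ?yx p, ?yu p} = 4"
      using vec.dim_insert[of "w2 p" "{y p, ?yx p, ?yu p, v p}"] T[OF p] by (simp add: insert_commute)
    then show "meet_in_line (pl p (vector [0, 1])) (vec.span {y p, ?yx p, ?yu p})"
      unfolding pl01 meet_in_line_iff_dim[OF dims(3)[OF p] T(2)[OF p]] .
    fix d :: "complex ^ 2"
    assume d: "d \<noteq> 0 \<and> meet_in_line (pl p d) (vec.span {y p, ?yx p, ?yu p})"
    let ?w = "d $ 1 *s w1 p + d $ 2 *s w2 p"
    have d1: "d $ 1 = 0"
    proof (rule ccontr)
      assume "d $ 1 \<noteq> 0"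
      moreover obtain N where "det5 N (y p) (?yx p) (?yu p) (?yxx p) (?yxu p) \<noteq> 0" using exN[OF p] by blast
      ultimately have 5: "vec.dim {y p, ?yx p, ?yu p, v p, ?w} = 5"
        by (intro dim_eq_5_if_det5[of N]) (simp add: frame)
      then have "vec.dim {y p, v p, ?w} = 3"
        using dim_3_le[of "y p" "v p" ?w] vec_dim_insert_le[of "?yx p" "{y p, ?yu p, v p, ?w}"]
          vec_dim_insert_le[of "?yu p" "{y p, v p, ?w}"] by (simp add: insert_commute)
      from meet_in_line_iff_dim[OF this T(2)[OF p]] show False
        using d 5 by (simp add: pl_def insert_commute)
    qed
    have d2: "d $ 2 \<noteq> 0" using d d1 by (auto simp: vec_eq_iff forall_2)
    \<comment> \<open>Once dx = 0, the plane depends only on a nonzero multiple of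
      \<open>w2\<close>, hence is the asymptotic one.\<close>
    have sub: "vec.span {y p, v p, s *s w2 p} \<subseteq> vec.span {y p, v p, t *s w2 p}" if "t \<noteq> 0" for s t
    proof -
      have "s *s w2 p = (s / t) *s (t *s w2 p)" using that by (simp add: vec_eq_iff)
      also have "\<dots> \<in> vec.span {y p, v p, t *s w2 p}" by (intro vec.span_scale vec.span_base) simp
      finally show ?thesis
        by (intro vec.span_minimal vec.subspace_span) (auto intro: vec.span_base)
    qed
    show "pl p d = pl p (vector [0, 1])"
      using sub[OF d2, of 1] sub[of 1 "d $ 2"] d1 unfolding pl01 by (auto simp: pl_def)
  qed
  show thesis
  proof (rule that[OF rel asy], rule pencil_system_eq_cubic_ode_system[OF U y])
    fix p m r assume p: "p \<in> U"
    obtain N where E: "det5 N (y p) (?yx p) (?yu p) (?yxx p) (?yxu p) \<noteq> 0" using exN[OF p] by blast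
    let ?w = "w1 p + m *s w2 p" and ?g = "?yx p + m *s ?yu p"
      and ?h = "?yxx p + (2 * m) *s ?yxu p + m\<^sup>2 *s ?yuu p"
    let ?cubic = "A p + B p * m + C p * m\<^sup>2 + D p * m ^ 3"
    have fr: "det5 N (y p) (?yx p) (?yu p) (v p) ?w = det5 N (y p) (?yx p) (?yu p) (?yxx p) (?yxu p)"
      using frame[of N p 1 m] by simp
    have root: "- X * K + r * K = 0 \<longleftrightarrow> r = X" if "K \<noteq> 0" for X K :: complex
    proof -
      have "- X * K + r * K = (r - X) * K" by (simp add: algebra_simps)
      then show ?thesis using that by simp
    qed
    have CD: "C p = 2 - b p - 2 * \<gamma> p" "D p = a p - 2 * \<eta> p" by (simp_all add: \<gamma>_def \<eta>_def field_simps)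
    \<comment> \<open>The second derivative without its u'' part, decomposed along \<open>y\<close>,
      the tangent vector, \<open>partial_u y\<close>, \<open>v\<close> and \<open>?w\<close>. The
      multiple of the tangent vector is fixed by the coefficient of \<open>partial_x y\<close>; what
      then remains on \<open>partial_u y\<close> is minus the prescribed cubic.\<close>
    have h: "?h = v p + (2 * m) *s ?w + (m\<^sup>2 * c p) *s y p
        + (m\<^sup>2 * a p + B p - 2 * m * \<gamma> p - 2 * m\<^sup>2 * \<eta> p) *s ?g + (- ?cubic) *s ?yu p"
      unfolding yuu[OF p] v_def w1_def w2_def CD
      by (simp add: vec_eq_iff algebra_simps power2_eq_square power3_eq_cube)
    have "meet_in_line (osculating_span y p m r) (pl p (vector [1, m])) \<longleftrightarrow>
      det5 N (y p) ?g ?h (v p) ?w + r * det5 N (y p) (?yx p) (?yu p) (v p) ?w = 0"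
      unfolding osculating_span_def pl_def vector_2 vec.scale_one
    proof (rule meet_osculating_iff_det5[OF E yuu[OF p] _ _ refl])
      show "{v p, ?w} \<subseteq> vec.span {y p, ?yx p, ?yu p, ?yxx p, ?yxu p}"
        using mem[of p] by (auto intro!: vec.span_add vec.span_scale)
    qed (use E fr in simp)
    \<comment> \<open>Every term of \<open>h\<close> except the one along \<open>partial_u y\<close>
      repeats another row of the determinant.\<close>
    also have "det5 N (y p) ?g ?h (v p) ?w = - ?cubic * det5 N (y p) ?g (?yu p) (v p) ?w"
      unfolding h by (simp only: det5_add(3) det5_scale(3) det5_same) simp
    also have "det5 N (y p) ?g (?yu p) (v p) ?w = det5 N (y p) (?yx p) (?yu p) (v p) ?w"
      by (simp only: det5_add(2) det5_scale(2) det5_same) simp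
    also have "- ?cubic * det5 N (y p) (?yx p) (?yu p) (v p) ?w + r * det5 N (y p) (?yx p) (?yu p) (v p) ?w = 0
        \<longleftrightarrow> r = ?cubic"
      unfolding fr by (rule root[OF E])
    finally show "meet_in_line (osculating_span y p m r) (pl p (vector [1, m])) \<longleftrightarrow> r = ?cubic" .
  qed
qed

theorem theorem2p11:
  fixes y :: "complex \<times> complex \<Rightarrow> complex ^ 'n"
    and U :: "(complex \<times> complex) set"
  assumes "surface_with_asymptotics U y"
  shows
    "(\<forall>pl. related_pencil_field U y pl \<and> asymptotic_plane_condition U y pl \<longrightarrow>
        (\<exists>A B C D. analytic2_on A U \<and> analytic2_on B U \<and> analytic2_on C U \<and> analytic2_on D U \<and>
           pencil_system U y pl = cubic_ode_system U A B C D))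
     \<and>
     (\<forall>A B C D. analytic2_on A U \<and> analytic2_on B U \<and> analytic2_on C U \<and> analytic2_on D U \<longrightarrow>
        (\<exists>pl. related_pencil_field U y pl \<and> asymptotic_plane_condition U y pl \<and>
           pencil_system U y pl = cubic_ode_system U A B C D))"
proof (intro conjI allI impI)
  fix pl assume "related_pencil_field U y pl \<and> asymptotic_plane_condition U y pl"
  then show "\<exists>A B C D. analytic2_on A U \<and> analytic2_on B U \<and> analytic2_on C U \<and> analytic2_on D U \<and>
      pencil_system U y pl = cubic_ode_system U A B C D"
    by (elim conjE) (rule pencil_system_is_cubic[OF assms]; blast)
next
  fix A B C D assume "analytic2_on A U \<and> analytic2_on B U \<and> analytic2_on C U \<and> analytic2_on D U"
  then show "\<exists>pl. related_pencil_field U y pl \<and> asymptotic_plane_condition U y pl \<and>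
      pencil_system U y pl = cubic_ode_system U A B C D"
    by (elim conjE) (rule cubic_is_pencil_system[OF assms]; blast)
qed

end
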